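(* Let $1\le r<d$ be integers, let $E\in\mathbb{R}^{d\times r}$ satisfy $E^TE=I_r$, fix $\sigma>0$, and let $p_X=\mathcal{N}(0,EE^T)$ and $p_{Y,\sigma}=\mathcal{N}(0,EE^T+\sigma^2I_d)$. Let $(\sigma_t)_{t\in(0,1)}\subseteq[\sigma_{\min},\sigma_{\max}]$ be any bounded (measurable) noise schedule with $0<\sigma_{\min}<\sigma_{\max}<\infty$. Consider parameters $\theta=(U,V)$, $U,V\in\mathbb{R}^{d\times r}$, in $$\Theta:=\{(U,V): U^TU=I_r,\ V^TV\succ0\},$$ and the loss $$\mathcal{L}(\theta)=\mathbb{E}_{t\sim\mathrm{Unif}(0,1)}\,\mathbb{E}_{x_t\sim p^{\sigma_t}_{G_\theta}}\left[\left\|s_{\sigma,\sigma_t}(x_t)-\nabla\log p^{\sigma_t}_{G_\theta}(x_t)\right\|_2^2\right],$$ where $p^{\sigma_t}_{G_\theta}=\mathcal{N}(0,UV^TVU^T+\sigma_t^2I_d)$ and $s_{\sigma,\sigma_t}(x)=-(EE^T+(\sigma^2+\sigma_t^2)I_d)^{-1}x$. Then the global minimizers $\theta^*_\sigma=(U^*,V^*_\sigma)$ of $\mathcal{L}$ over $\Theta$ satisfy $$U^*=EQ\ \text{ for some orthogonal matrix } Q\in\mathbb{R}^{r\times r},\qquad (V^*_\sigma)^TV^*_\sigma=(1+\sigma^2)I_r.$$ For any such $\theta^*_\sigma$, the induced generator distribution $p_{G_{\theta^*_\sigma}}=\mathcal{N}(0,(1+\sigma^2)EE^T)$ satisfies 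$$W_2^2(p_{G_{\theta^*_\sigma}},p_X)=W_2^2(p_{Y,\sigma},p_X)-(d-r)\sigma^2<W_2^2(p_{Y,\sigma},p_X).$$
   Context: For $\theta=(U,V)$ the generator is $G_\theta(z)=UV^Tz$, $z\sim\mathcal{N}(0,I_d)$, and $p_{G_\theta}=\mathcal{N}(0,UV^TVU^T)$ denotes the law of $G_\theta(z)$ (a possibly degenerate Gaussian). $p^{\sigma_t}_{G_\theta}$ is the law of $x+\sigma_t\epsilon$ with $x\sim p_{G_\theta}$ and $\epsilon\sim\mathcal{N}(0,I_d)$ independent. $p_{Y,\sigma}$ is the law of $x+\sigma\epsilon$ with $x\sim p_X$. $W_2$ is the Wasserstein-2 distance; $V^TV\succ0$ means positive definite. *)

theory Defs
  imports "HOL-Analysis.Analysis" "HOL-Probability.Probability"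
begin

definition positive_definite :: "real^'n^'n \<Rightarrow> bool" where
  "positive_definite A \<longleftrightarrow> transpose A = A \<and> (\<forall>x. x \<noteq> 0 \<longrightarrow> 0 < x \<bullet> (A *v x))"

definition std_normal :: "(real^'n) measure" where
  "std_normal = density lborel (\<lambda>z. ennreal (\<Prod>i\<in>UNIV. std_normal_density (z $ i)))"

text \<open>
  The normal law with mean \<open>m\<close> and covariance \<open>S\<close>, possibly degenerate, is the law of \<open>m + A z\<close>
  with \<open>z\<close> standard normal and \<open>A A\<^sup>T = S\<close>. Such an \<open>A\<close> exists exactly when \<open>S\<close> is symmetric
  positive semidefinite, and the law does not depend on which one is chosen.
\<close>
definition normal_law :: "real^'n \<Rightarrow> real^'n^'n \<Rightarrow> (real^'n) measure" where
  "normal_law m S =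
     distr std_normal borel (\<lambda>z. m + (SOME A::real^'n^'n. A ** transpose A = S) *v z)"

text \<open>The law of \<open>x + s \<epsilon>\<close>, where \<open>x\<close> has law \<open>M\<close> and \<open>\<epsilon>\<close> is standard normal, independent of \<open>x\<close>.\<close>
definition add_noise :: "real \<Rightarrow> (real^'n) measure \<Rightarrow> (real^'n) measure" where
  "add_noise s M = distr (M \<Otimes>\<^sub>M std_normal) borel (\<lambda>(x, e). x + s *\<^sub>R e)"

text \<open>
  A Lebesgue density is determined only almost everywhere, so to differentiate it we take the
  continuous version, which is unique whenever it exists.
\<close>
definition continuous_density :: "(real^'n) measure \<Rightarrow> real^'n \<Rightarrow> real" where
  "continuous_density M = (THE f. continuous_on UNIV f \<and> (\<forall>x. 0 \<le> f x) \<and>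
     M = density lborel (\<lambda>x. ennreal (f x)))"

definition score :: "(real^'n) measure \<Rightarrow> real^'n \<Rightarrow> real^'n" where
  "score M x = (THE g. GDERIV (\<lambda>y. ln (continuous_density M y)) x :> g)"

definition couplings :: "(real^'n) measure \<Rightarrow> (real^'n) measure \<Rightarrow> ((real^'n) \<times> (real^'n)) measure set"
  where "couplings M N =
     {P. sets P = sets (borel \<Otimes>\<^sub>M borel) \<and> distr P borel fst = M \<and> distr P borel snd = N}"

text \<open>The infimum is finite when both measures are probability laws with finite second moment.\<close>
definition W2 :: "(real^'n) measure \<Rightarrow> (real^'n) measure \<Rightarrow> real" where
  "W2 M N = sqrt (enn2real
     (INF P \<in> couplings M N. \<integral>\<^sup>+ (x, y). ennreal ((norm (x - y))\<^sup>2) \<partial>P))"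

type_synonym ('r, 'd) param = "(real^'r^'d) \<times> (real^'r^'d)"

definition Theta :: "('r::finite, 'd::finite) param set" where
  "Theta = {(U, V). transpose U ** U = mat 1 \<and> positive_definite (transpose V ** V)}"

definition generator :: "('r::finite, 'd::finite) param \<Rightarrow> real^'d \<Rightarrow> real^'d" where
  "generator = (\<lambda>(U, V) z. (U ** transpose V) *v z)"

definition generator_law :: "('r::finite, 'd::finite) param \<Rightarrow> (real^'d) measure" where
  "generator_law \<theta> = distr std_normal borel (generator \<theta>)"

definition data_score :: "real^'r^'d \<Rightarrow> real \<Rightarrow> real \<Rightarrow> real^'d \<Rightarrow> real^'d" where
  "data_score E \<sigma> s x =
     - (matrix_inv (E ** transpose E + (\<sigma>\<^sup>2 + s\<^sup>2) *\<^sub>R mat 1) *v x)"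

text \<open>
  The integrand is nonnegative, so the expectations are taken in \<open>[0, \<infinity>]\<close> and no
  integrability condition is needed.
\<close>
definition loss :: "real^'r^'d \<Rightarrow> real \<Rightarrow> (real \<Rightarrow> real) \<Rightarrow> ('r::finite, 'd::finite) param \<Rightarrow> ennreal"
  where "loss E \<sigma> \<tau> \<theta> =
    (\<integral>\<^sup>+ t. (\<integral>\<^sup>+ x. ennreal ((norm (data_score E \<sigma> (\<tau> t) x
                - score (add_noise (\<tau> t) (generator_law \<theta>)) x))\<^sup>2)
          \<partial>(add_noise (\<tau> t) (generator_law \<theta>)))
      \<partial>(uniform_measure lborel {0<..<1}))"

end

theory Submission
  imports Defs
begin

text \<open>
  Every law involved is a linear image \<open>f z\<close> of a standard Gaussian vector \<open>z\<close>. By rotation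
  invariance such a law depends only on the covariance \<open>f f\<^sup>*\<close>: if \<open>f f\<^sup>* = g g\<^sup>*\<close>, then
  \<open>f\<^sup>* y \<mapsto> g\<^sup>* y\<close> is an isometry, it extends to an orthogonal map \<open>T\<close>, and \<open>f = g \<circ> T\<close>.

  At noise level \<open>s\<close> put \<open>P = E E\<^sup>T\<close>, \<open>W = V\<^sup>T V\<close>, \<open>N = (W + s\<^sup>2 I)\<inverse>\<close>, \<open>\<alpha> = 1 / (1 + \<sigma>\<^sup>2 + s\<^sup>2)\<close>,
  \<open>\<beta> = 1 / (\<sigma>\<^sup>2 + s\<^sup>2)\<close> and \<open>H = W - (1 + \<sigma>\<^sup>2) I\<close>. A trace computation gives the inner expectation as
  \<open>(d - r) s\<^sup>2 (1 / s\<^sup>2 - \<beta>)\<^sup>2 + \<alpha>\<^sup>2 tr (H N H) + (\<beta>\<^sup>2 - \<alpha>\<^sup>2) \<parallel>(I - P) U V\<^sup>T\<parallel>\<^sup>2\<close>.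
  The first term does not depend on the parameter, and the other two are nonnegative and vanish
  together exactly when \<open>W = (1 + \<sigma>\<^sup>2) I\<close> and \<open>P U = U\<close>, whatever the value of \<open>s\<close>.

  For the distances, \<open>2 x \<bullet> y = 2 P x \<bullet> y \<le> \<parallel>P x\<parallel>\<^sup>2 / a + a \<parallel>y\<parallel>\<^sup>2\<close> for \<open>y\<close> in the range of \<open>P\<close>
  bounds the cost of every coupling from below by that of \<open>(a P z + b (I - P) z, P z)\<close>.
\<close>

subsection \<open>Lebesgue measure under linear maps\<close>

lemma nn_integral_lborel_translate:
  fixes h :: "'a::euclidean_space \<Rightarrow> ennreal"
  assumes [measurable]: "h \<in> borel_measurable borel"
  shows "(\<integral>\<^sup>+x. h (c + x) \<partial>lborel) = (\<integral>\<^sup>+x. h x \<partial>lborel)"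
  by (subst (2) lborel_distr_plus[symmetric, of c]) (simp add: nn_integral_distr)

lemma nn_integral_lborel_reflect:
  fixes h :: "'a::euclidean_space \<Rightarrow> ennreal"
  assumes [measurable]: "h \<in> borel_measurable borel"
  shows "(\<integral>\<^sup>+x. h (c - x) \<partial>lborel) = (\<integral>\<^sup>+x. h x \<partial>lborel)"
proof -
  have "(\<integral>\<^sup>+x. h x \<partial>lborel)
      = (\<integral>\<^sup>+x. h x \<partial>density (distr lborel borel (\<lambda>x. c + (-1) *\<^sub>R x)) (\<lambda>_. ennreal (\<bar>-1\<bar> ^ DIM('a))))"
    by (subst lborel_affine[of "-1" c, symmetric]) simp_all
  also have "\<dots> = (\<integral>\<^sup>+x. h (c - x) \<partial>lborel)"
    by (subst nn_integral_density) (simp_all add: nn_integral_distr)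
  finally show ?thesis ..
qed

lemma linear_borel_measurable:
  fixes f :: "'a::euclidean_space \<Rightarrow> 'b::euclidean_space"
  assumes "linear f" shows "f \<in> borel_measurable borel"
  using assms linear_continuous_on linear_conv_bounded_linear
  by (auto intro!: borel_measurable_continuous_onI)

text \<open>The image measure is translation invariant, and Tonelli's theorem compares it with Lebesgue
  measure. This determines the image up to the factor \<open>\<bar>det f\<bar>\<close>, whose value is never needed.\<close>

lemma emeasure_lborel_linear_vimage_cross:
  fixes f :: "'a::euclidean_space \<Rightarrow> 'a"
  assumes f: "linear f" "bij f" and [measurable]: "A \<in> sets borel" "B \<in> sets borel"
  shows "emeasure lborel (f -` A) * emeasure lborel B = emeasure lborel (f -` B) * emeasure lborel A"
proof -
  have [measurable]: "f \<in> borel_measurable borel"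
    by (rule linear_borel_measurable[OF f(1)])
  have vim: "emeasure lborel (f -` A) = (\<integral>\<^sup>+x. indicator A (f x) \<partial>lborel)"
    if [measurable]: "A \<in> sets borel" for A
  proof -
    have "f -` A \<in> sets borel"
      using measurable_sets[of f borel borel A] by simp
    then show ?thesis
      by (simp add: indicator_vimage[symmetric] flip: nn_integral_indicator)
  qed
  have sub: "f (inv f (- y) + x) = f x - y" for x y
    using f by (simp add: linear_add surj_f_inv_f bij_is_surj)
  have "emeasure lborel (f -` A) * emeasure lborel B
      = (\<integral>\<^sup>+x. (\<integral>\<^sup>+y. indicator A (f x) * indicator B (f x + y) \<partial>lborel) \<partial>lborel)"
    by (simp add: vim nn_integral_cmult nn_integral_lborel_translate nn_integral_multc)
  also have "\<dots> = (\<integral>\<^sup>+y. (\<integral>\<^sup>+x. indicator A (f x) * indicator B (f x + y) \<partial>lborel) \<partial>lborel)"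
    by (rule lborel_pair.Fubini'[symmetric]) simp
  \<comment> \<open>For fixed \<open>y\<close>, translating \<open>x\<close> by
    \<open>inv f (- y)\<close> turns \<open>f x + y\<close> into \<open>f x\<close> and
    \<open>f x\<close> into \<open>f x - y\<close>, by \<open>sub\<close>.\<close>
  also have "\<dots> = (\<integral>\<^sup>+y. (\<integral>\<^sup>+x. indicator A (f x - y) * indicator B (f x) \<partial>lborel) \<partial>lborel)"
  proof (rule nn_integral_cong)
    fix y
    show "(\<integral>\<^sup>+x. indicator A (f x) * indicator B (f x + y) \<partial>lborel)
        = (\<integral>\<^sup>+x. indicator A (f x - y) * (indicator B (f x)::ennreal) \<partial>lborel)"
      using nn_integral_lborel_translate[of "\<lambda>x. indicator A (f x) * indicator B (f x + y)" "inv f (- y)"]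
      by (simp add: sub)
  qed
  also have "\<dots> = (\<integral>\<^sup>+x. (\<integral>\<^sup>+y. indicator A (f x - y) * indicator B (f x) \<partial>lborel) \<partial>lborel)"
    by (rule lborel_pair.Fubini') simp
  also have "\<dots> = emeasure lborel (f -` B) * emeasure lborel A"
    by (simp add: vim nn_integral_multc nn_integral_lborel_reflect nn_integral_cmult mult.commute)
  finally show ?thesis .
qed

lemma emeasure_lborel_open_pos:
  fixes S :: "'a::euclidean_space set"
  assumes "open S" "S \<noteq> {}" shows "emeasure lborel S > 0"
proof -
  have "emeasure lebesgue S \<noteq> 0"
    using assms open_not_negligible[of S] negligible_iff_emeasure0[of S] by auto
  then show ?thesis
    using assms(1) by (simp add: borel_open zero_less_iff_neq_zero)
qed

text \<open>Choosing the unit ball as second set in the cross identity and dividing by its positive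
  finite volume isolates the volume of the preimage. The factor is kept as a quotient of volumes,
  which can be evaluated for orthogonal maps.\<close>

lemma distr_lborel_linear_cross:
  fixes f :: "'a::euclidean_space \<Rightarrow> 'a"
  assumes f: "linear f" "bij f"
  shows "distr lborel borel f
    = density lborel (\<lambda>_. emeasure lborel (f -` ball 0 1) / emeasure lborel (ball (0::'a) 1))"
    (is "?L = density lborel (\<lambda>_. ?c)")
proof (rule measure_eqI)
  fix A assume "A \<in> sets ?L"
  then have A [measurable]: "A \<in> sets borel" by simp
  have b: "emeasure lborel (ball (0::'a) 1) > 0" "emeasure lborel (ball (0::'a) 1) < \<infinity>"
    by (auto intro: emeasure_lborel_open_pos simp: emeasure_lborel_ball_finite[simplified])
  have "emeasure ?L A = emeasure lborel (f -` A)"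
    using linear_borel_measurable[OF f(1)] A by (simp add: emeasure_distr)
  also have "\<dots> = emeasure lborel (f -` A) * emeasure lborel (ball (0::'a) 1) / emeasure lborel (ball (0::'a) 1)"
    using b by (metis ennreal_mult_divide_eq less_irrefl infinity_ennreal_def)
  also have "\<dots> = ?c * emeasure lborel A"
    by (subst emeasure_lborel_linear_vimage_cross[OF f A]) (auto simp: ennreal_times_divide mult.commute)
  finally show "emeasure ?L A = emeasure (density lborel (\<lambda>_. ?c)) A"
    using A by (simp add: emeasure_density nn_integral_cmult_indicator)
qed simp

text \<open>The preimage of the unit ball is open and contains 0, and it is bounded, being the image
  of the ball under the linear inverse. Hence the quotient of volumes is positive and
  finite.\<close>

lemma distr_lborel_linear:
  fixes f :: "'a::euclidean_space \<Rightarrow> 'a"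
  assumes f: "linear f" "bij f"
  obtains c :: real where "0 < c" "distr lborel borel f = density lborel (\<lambda>_. ennreal c)"
proof -
  define B :: "'a set" where "B = ball 0 1"
  have "open (f -` B)" unfolding B_def
    using f(1) by (intro continuous_open_vimage)
      (auto intro: linear_continuous_at simp: linear_conv_bounded_linear)
  moreover have "0 \<in> f -` B" unfolding B_def using f(1) by (simp add: linear_0)
  ultimately have pos: "emeasure lborel (f -` B) > 0"
    by (intro emeasure_lborel_open_pos) auto
  have "f -` B = inv f ` B"
    using f(2) by (simp add: bij_vimage_eq_inv_image)
  then have "bounded (f -` B)"
    unfolding B_def using f bounded_linear_image[of "ball 0 1" "inv f"] inj_linear_imp_inv_linear[of f]
    by (simp add: bij_is_inj linear_conv_bounded_linear)
  then have fin: "emeasure lborel (f -` B) < \<infinity>"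
    by (rule emeasure_bounded_finite)
  have b: "emeasure lborel B > 0" "emeasure lborel B < \<infinity>"
    unfolding B_def by (auto intro: emeasure_lborel_open_pos simp: emeasure_lborel_ball_finite[simplified])
  define c where "c = emeasure lborel (f -` B) / emeasure lborel B"
  have "c < \<infinity>" unfolding c_def using b fin
    by (auto simp: ennreal_divide_eq_top_iff less_top[symmetric])
  moreover have "0 < c" unfolding c_def using pos b
    by (simp add: ennreal_zero_less_divide)
  ultimately obtain r where "c = ennreal r" "0 < r"
    by (cases c) auto
  then show thesis
    using that distr_lborel_linear_cross[OF f] unfolding c_def B_def by metis
qed

text \<open>An orthogonal map preserves the unit ball, so the quotient of volumes is 1.\<close>

lemma distr_lborel_orthogonal:
  fixes f :: "'a::euclidean_space \<Rightarrow> 'a"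
  assumes f: "orthogonal_transformation f"
  shows "distr lborel borel f = lborel"
proof -
  have "f -` ball 0 1 = ball 0 1"
    using f by (auto simp: orthogonal_transformation)
  moreover have "emeasure lborel (ball (0::'a) 1) > 0" "emeasure lborel (ball (0::'a) 1) < \<infinity>"
    by (auto intro: emeasure_lborel_open_pos simp: emeasure_lborel_ball_finite[simplified])
  ultimately show ?thesis
    using distr_lborel_linear_cross[of f] f
    by (simp add: orthogonal_transformation_linear orthogonal_transformation_bij ennreal_divide_self density_1)
qed

subsection \<open>Standard Gaussian measures on Euclidean spaces\<close>

text \<open>Set up on every Euclidean space, so that a pair of independent Gaussian vectors is
  covered by the same definition.\<close>

definition gauss :: "'a::euclidean_space measure" where
  "gauss = density lborel (\<lambda>x. ennreal (\<Prod>b\<in>Basis. std_normal_density (x \<bullet> b)))"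

text \<open>The density depends on \<open>x\<close> only through its norm, which is the source of
  rotation invariance.\<close>

lemma prod_std_normal_density:
  "(\<Prod>b\<in>Basis. std_normal_density ((x::'a::euclidean_space) \<bullet> b))
    = (1 / sqrt (2 * pi)) ^ DIM('a) * exp (- (norm x)\<^sup>2 / 2)"
proof -
  have "(\<Prod>b\<in>Basis. std_normal_density (x \<bullet> b))
      = (1 / sqrt (2 * pi)) ^ DIM('a) * exp (\<Sum>b\<in>Basis. - (x \<bullet> b)\<^sup>2 / 2)"
    by (simp add: std_normal_density_def prod.distrib exp_sum power_one_over prod_dividef)
  also have "(\<Sum>b\<in>Basis. - (x \<bullet> b)\<^sup>2 / 2) = - (norm x)\<^sup>2 / 2"
    by (subst norm_eq_sqrt_inner, subst euclidean_inner)
      (simp add: sum_nonneg power2_eq_square sum_negf flip: sum_divide_distrib)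
  finally show ?thesis .
qed

lemma sets_gauss [simp, measurable_cong]: "sets gauss = sets borel"
  and space_gauss [simp]: "space gauss = UNIV"
  by (simp_all add: gauss_def)

lemma prob_space_gauss: "prob_space (gauss :: 'a::euclidean_space measure)"
proof
  have "(\<integral>\<^sup>+x. (\<Prod>b\<in>Basis. ennreal (std_normal_density ((x::'a) \<bullet> b))) \<partial>lborel)
      = (\<Prod>b\<in>(Basis::'a set). \<integral>\<^sup>+x. ennreal (std_normal_density x) \<partial>lborel)"
    by (rule nn_integral_lborel_prod) simp_all
  also have "\<dots> = 1"
    by (simp add: nn_integral_eq_integral normal_density_nonneg)
  finally show "emeasure (gauss :: 'a measure) (space gauss) = 1"
    by (simp add: gauss_def emeasure_density prod_ennreal normal_density_nonneg)
qed

lemma distr_gauss_orthogonal: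
  fixes f :: "'a::euclidean_space \<Rightarrow> 'a"
  assumes f: "orthogonal_transformation f"
  shows "distr gauss borel f = gauss"
proof -
  have [measurable]: "f \<in> borel_measurable borel"
    using f by (simp add: linear_borel_measurable orthogonal_transformation_linear)
  have "gauss = density (distr lborel borel f) (\<lambda>x. ennreal (\<Prod>b\<in>Basis. std_normal_density ((x::'a) \<bullet> b)))"
    by (simp add: gauss_def distr_lborel_orthogonal[OF f])
  also have "\<dots> = distr gauss borel f"
    unfolding gauss_def prod_std_normal_density using f
    by (subst density_distr) (simp_all add: orthogonal_transformation)
  finally show ?thesis ..
qed

text \<open>The exponentials multiply because the squared norm of a pair is a sum. Two independent
  Gaussian vectors thus become one, to which a single linear map can be applied.\<close>

lemma gauss_pair: "gauss \<Otimes>\<^sub>M gauss = (gauss :: ('a::euclidean_space \<times> 'b::euclidean_space) measure)"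
proof -
  interpret G: prob_space "gauss :: 'b measure" by (rule prob_space_gauss)
  have "gauss \<Otimes>\<^sub>M gauss = density (lborel \<Otimes>\<^sub>M lborel) (\<lambda>(x::'a, y::'b).
      ennreal (\<Prod>b\<in>Basis. std_normal_density (x \<bullet> b)) * ennreal (\<Prod>b\<in>Basis. std_normal_density (y \<bullet> b)))"
    unfolding gauss_def
    using G.sigma_finite_measure_axioms
    by (intro pair_measure_density) (simp_all add: gauss_def sigma_finite_lborel)
  also have "(\<lambda>(x::'a, y::'b).
        ennreal (\<Prod>b\<in>Basis. std_normal_density (x \<bullet> b)) * ennreal (\<Prod>b\<in>Basis. std_normal_density (y \<bullet> b)))
      = (\<lambda>p. ennreal (\<Prod>b\<in>Basis. std_normal_density (p \<bullet> b)))"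
  proof (rule ext, clarify)
    fix x :: 'a and y :: 'b
    have "exp (- (norm x)\<^sup>2 / 2) * exp (- (norm y)\<^sup>2 / 2) = exp (- (norm (x, y))\<^sup>2 / 2)"
      by (simp add: norm_Pair add_divide_distrib flip: exp_add)
    then show "ennreal (\<Prod>b\<in>Basis. std_normal_density (x \<bullet> b)) * ennreal (\<Prod>b\<in>Basis. std_normal_density (y \<bullet> b))
        = ennreal (\<Prod>b\<in>Basis. std_normal_density ((x, y) \<bullet> b))"
      unfolding prod_std_normal_density
      by (simp add: power_add mult.assoc mult.left_commute flip: ennreal_mult)
  qed
  also have "density (lborel \<Otimes>\<^sub>M lborel) \<dots> = gauss"
    by (simp add: lborel_prod gauss_def)
  finally show ?thesis .
qed

lemma std_normal_eq_gauss: "(std_normal :: (real^'n) measure) = gauss"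
proof -
  have "(\<Prod>b\<in>Basis. std_normal_density (x \<bullet> b)) = (\<Prod>i\<in>UNIV. std_normal_density (x $ i))" for x :: "real^'n"
  proof -
    have B: "(Basis :: (real^'n) set) = (\<lambda>i. axis i 1) ` UNIV"
      by (auto simp: Basis_vec_def)
    show ?thesis
      unfolding B by (subst prod.reindex) (auto simp: inj_on_def axis_eq_axis inner_axis)
  qed
  then show ?thesis
    by (simp add: std_normal_def gauss_def)
qed

lemma distr_gauss_fst: "distr (gauss :: ('a::euclidean_space \<times> 'b::euclidean_space) measure) borel fst = gauss"
proof -
  interpret G: prob_space "gauss :: 'b measure" by (rule prob_space_gauss)
  have "distr (gauss \<Otimes>\<^sub>M (gauss :: 'b measure)) gauss fst = (gauss :: 'a measure)"
    by (rule G.distr_pair_fst)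
  moreover have "distr (gauss \<Otimes>\<^sub>M (gauss :: 'b measure)) gauss fst
      = distr (gauss \<Otimes>\<^sub>M gauss) borel (fst :: 'a \<times> 'b \<Rightarrow> 'a)"
    by (rule distr_cong) simp_all
  ultimately show ?thesis by (simp add: gauss_pair)
qed

declare transpose_matrix_vector [simp del]

subsection \<open>Laws of linear images of a standard Gaussian\<close>

text \<open>The Householder reflection in the hyperplane orthogonal to \<open>n\<close>. For
  \<open>n = 0\<close> the division by zero yields 0 and the map is the identity, which is
  orthogonal too.\<close>

lemma orthogonal_transformation_reflection:
  fixes n :: "'a::euclidean_space"
  shows "orthogonal_transformation (\<lambda>w. w - (2 * (w \<bullet> n) / (n \<bullet> n)) *\<^sub>R n)"
  unfolding orthogonal_transformation_def
proof (intro conjI allI)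
  show "linear (\<lambda>w. w - (2 * (w \<bullet> n) / (n \<bullet> n)) *\<^sub>R n)"
    by (rule linearI) (simp_all add: inner_simps algebra_simps add_divide_distrib)
  fix v w
  show "(v - (2 * (v \<bullet> n) / (n \<bullet> n)) *\<^sub>R n) \<bullet> (w - (2 * (w \<bullet> n) / (n \<bullet> n)) *\<^sub>R n) = v \<bullet> w"
    by (cases "n = 0") (simp_all add: inner_simps inner_commute field_simps)
qed

text \<open>Polarization: the inner product is determined by the norms at \<open>x\<close>,
  \<open>y\<close> and \<open>x + y\<close>.\<close>

lemma inner_eq_if_norm_eq:
  fixes p :: "'b::real_vector \<Rightarrow> 'a::real_inner" and q :: "'b \<Rightarrow> 'c::real_inner"
  assumes "linear p" "linear q" "\<And>y. norm (p y) = norm (q y)"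
  shows "p x \<bullet> p y = q x \<bullet> q y"
  using assms(3)[of x] assms(3)[of y] assms(3)[of "x + y"]
  by (simp add: dot_norm linear_add[OF assms(1)] linear_add[OF assms(2)])

text \<open>Vectors are matched one at a time: the reflection exchanging \<open>T (p b)\<close> and \<open>q b\<close>, which have
  the same length, fixes every \<open>q b'\<close> already matched.\<close>

lemma orthogonal_transformation_intertwines:
  fixes p q :: "'b::euclidean_space \<Rightarrow> 'a::euclidean_space"
  assumes lin: "linear p" "linear q" and norm: "\<And>y. norm (p y) = norm (q y)"
  obtains T where "orthogonal_transformation T" "\<And>y. T (p y) = q y"
proof -
  note ip = inner_eq_if_norm_eq[OF lin norm]
  have "\<exists>T. orthogonal_transformation T \<and> (\<forall>b\<in>B. T (p b) = q b)" if "finite B" for B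
    using that
  proof induction
    case empty
    show ?case by (rule exI[of _ "\<lambda>x. x"]) simp
  next
    case (insert b B)
    then obtain T where T: "orthogonal_transformation T" "\<And>b. b \<in> B \<Longrightarrow> T (p b) = q b"
      by blast
    have Ti: "T x \<bullet> T y = x \<bullet> y" for x y
      using T(1) by (simp add: orthogonal_transformation_def)
    define n where "n = T (p b) - q b"
    define R where "R = (\<lambda>w. w - (2 * (w \<bullet> n) / (n \<bullet> n)) *\<^sub>R n)"
    have R: "orthogonal_transformation R"
      unfolding R_def by (rule orthogonal_transformation_reflection)
    have "R (T (p b)) = q b"
    proof (cases "n = 0")
      case False
      have "2 * (T (p b) \<bullet> n) = n \<bullet> n"
        using ip[of b b] Ti[of "p b" "p b"] by (simp add: n_def inner_simps inner_commute)
      then show ?thesis using False by (simp add: R_def) (simp add: n_def)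
    qed (simp add: R_def n_def)
    moreover have "R (T (p b')) = q b'" if "b' \<in> B" for b'
    proof -
      \<comment> \<open>Since \<open>T (p b') = q b'\<close>, both
        \<open>q b' \<bullet> T (p b)\<close> and \<open>q b' \<bullet> q b\<close> equal
        \<open>p b' \<bullet> p b\<close>.\<close>
      have "q b' \<bullet> n = 0"
        using T(2)[OF that] ip[of b' b] Ti[of "p b'" "p b"] by (simp add: n_def inner_simps)
      then show ?thesis using T(2)[OF that] by (simp add: R_def)
    qed
    ultimately show ?case
      using orthogonal_transformation_compose[OF R T(1)] by (intro exI[of _ "R \<circ> T"]) (auto simp: o_def)
  qed
  from this[of Basis] obtain T where T: "orthogonal_transformation T" "\<forall>b\<in>Basis. T (p b) = q b"
    by auto
  have "(\<lambda>y. T (p y)) = q"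
    using T lin linear_compose[of p T]
    by (intro linear_eq_stdbasis) (auto simp: orthogonal_transformation_linear o_def)
  with T(1) show thesis
    using that by metis
qed

text \<open>The norm hypothesis encodes equality of covariances: the squared norm of
  \<open>adjoint f y\<close> is the quadratic form of the covariance of \<open>f\<close> at
  \<open>y\<close>.\<close>

lemma distr_gauss_eqI_same:
  fixes f g :: "'a::euclidean_space \<Rightarrow> 'c::euclidean_space"
  assumes lin: "linear f" "linear g" and norm: "\<And>y. norm (adjoint f y) = norm (adjoint g y)"
  shows "distr gauss borel f = distr gauss borel g"
proof -
  obtain T where T: "orthogonal_transformation T" "\<And>y. T (adjoint f y) = adjoint g y"
    using orthogonal_transformation_intertwines[OF adjoint_linear adjoint_linear] lin norm by metis
  have "g (T x) \<bullet> y = f x \<bullet> y" for x y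
  proof -
    have "g (T x) \<bullet> y = T x \<bullet> T (adjoint f y)"
      using lin by (simp add: adjoint_works T(2))
    also have "\<dots> = f x \<bullet> y"
      using lin T(1) by (simp add: adjoint_works orthogonal_transformation_def)
    finally show ?thesis .
  qed
  then have "f = g \<circ> T"
    by (metis comp_apply ext vector_eq_rdot)
  moreover have "T \<in> borel_measurable borel" "g \<in> borel_measurable borel"
    using T(1) lin by (simp_all add: linear_borel_measurable orthogonal_transformation_linear)
  ultimately have "distr gauss borel f = distr (distr gauss borel T) borel g"
    by (simp add: distr_distr measurable_cong_sets[OF sets_gauss refl])
  then show ?thesis
    by (simp add: distr_gauss_orthogonal[OF T(1)])
qed

lemma borel_measurable_fst_snd [measurable]:
  "(fst :: 'a::euclidean_space \<times> 'b::euclidean_space \<Rightarrow> 'a) \<in> borel_measurable borel"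
  "(snd :: 'a::euclidean_space \<times> 'b::euclidean_space \<Rightarrow> 'b) \<in> borel_measurable borel"
  by (simp_all add: linear_borel_measurable linear_iff)

lemma borel_measurable_gauss [simp]: "borel_measurable gauss = borel_measurable borel"
  by (rule measurable_cong_sets) simp_all

lemma distr_gauss_comp_fst:
  fixes f :: "'a::euclidean_space \<Rightarrow> 'c::euclidean_space"
  assumes "linear f"
  shows "distr (gauss :: ('a \<times> 'b::euclidean_space) measure) borel (\<lambda>p. f (fst p)) = distr gauss borel f"
proof -
  have [measurable]: "f \<in> borel_measurable borel"
    by (rule linear_borel_measurable[OF assms])
  have "distr gauss borel f = distr (distr (gauss :: ('a \<times> 'b) measure) borel fst) borel f"
    by (simp add: distr_gauss_fst)
  also have "\<dots> = distr (gauss :: ('a \<times> 'b) measure) borel (\<lambda>p. f (fst p))"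
    by (subst distr_distr) (simp_all add: o_def)
  finally show ?thesis ..
qed

lemma distr_gauss_snd: "distr (gauss :: ('a::euclidean_space \<times> 'b::euclidean_space) measure) borel snd = gauss"
proof -
  define s where "s = (\<lambda>p::'a \<times> 'b. (snd p, fst p))"
  interpret G: pair_prob_space "gauss :: 'b measure" "gauss :: 'a measure"
    by (simp add: pair_prob_space_def pair_sigma_finite_def prob_space_gauss prob_space_imp_sigma_finite)
  have "gauss = distr (gauss :: ('a \<times> 'b) measure) borel s"
    using G.distr_pair_swap unfolding s_def gauss_pair
    by (simp add: case_prod_beta' cong: distr_cong)
  then have "distr (distr (gauss :: ('a \<times> 'b) measure) borel s) borel fst = gauss"
    by (metis distr_gauss_fst)
  then show ?thesis
    unfolding s_def by (subst (asm) distr_distr) (simp_all add: o_def borel_prod[symmetric])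
qed

lemma distr_gauss_comp_snd:
  fixes f :: "'b::euclidean_space \<Rightarrow> 'c::euclidean_space"
  assumes "linear f"
  shows "distr (gauss :: ('a::euclidean_space \<times> 'b) measure) borel (\<lambda>p. f (snd p)) = distr gauss borel f"
proof -
  have [measurable]: "f \<in> borel_measurable borel"
    by (rule linear_borel_measurable[OF assms])
  have "distr gauss borel f = distr (distr (gauss :: ('a \<times> 'b) measure) borel snd) borel f"
    by (simp add: distr_gauss_snd)
  also have "\<dots> = distr (gauss :: ('a \<times> 'b) measure) borel (\<lambda>p. f (snd p))"
    by (subst distr_distr) (simp_all add: o_def)
  finally show ?thesis ..
qed

text \<open>Different source spaces are reduced to a common one: on the product space,
  \<open>f\<close> reads the first component and \<open>g\<close> the second.\<close>

lemma distr_gauss_eqI: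
  fixes f :: "'a::euclidean_space \<Rightarrow> 'c::euclidean_space" and g :: "'b::euclidean_space \<Rightarrow> 'c"
  assumes lin: "linear f" "linear g" and norm: "\<And>y. norm (adjoint f y) = norm (adjoint g y)"
  shows "distr gauss borel f = distr gauss borel g"
proof -
  have "adjoint (\<lambda>p::'a \<times> 'b. f (fst p)) = (\<lambda>y. (adjoint f y, 0))"
    by (rule adjoint_unique) (simp add: adjoint_works[OF lin(1)] inner_prod_def)
  moreover have "adjoint (\<lambda>p::'a \<times> 'b. g (snd p)) = (\<lambda>y. (0, adjoint g y))"
    by (rule adjoint_unique) (simp add: adjoint_works[OF lin(2)] inner_prod_def)
  moreover have "linear (\<lambda>p::'a \<times> 'b. f (fst p))" "linear (\<lambda>p::'a \<times> 'b. g (snd p))"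
    using lin by (auto simp: linear_iff)
  ultimately have "distr (gauss :: ('a \<times> 'b) measure) borel (\<lambda>p. f (fst p))
      = distr (gauss :: ('a \<times> 'b) measure) borel (\<lambda>p. g (snd p))"
    by (intro distr_gauss_eqI_same) (simp_all add: norm)
  then show ?thesis
    by (simp add: distr_gauss_comp_fst distr_gauss_comp_snd lin)
qed

lemma norm_adjoint_power2:
  fixes f :: "'a::euclidean_space \<Rightarrow> 'c::euclidean_space"
  assumes "linear f"
  shows "(norm (adjoint f y))\<^sup>2 = f (adjoint f y) \<bullet> y"
  by (simp add: adjoint_works[OF assms] power2_norm_eq_inner)

section \<open>Square factors of a covariance matrix and the resulting normal law\<close>

lemma inner_matrix_vector_left:
  fixes A :: "real^'n^'m" shows "(A *v x) \<bullet> y = x \<bullet> (transpose A *v y)"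
  by (metis adjoint_matrix adjoint_works matrix_vector_mul_linear)

text \<open>The source of \<open>f\<close> may have a larger dimension than its target, but the
  range of \<open>adjoint f\<close> has dimension at most \<open>CARD('d)\<close> and embeds
  isometrically into \<open>real^'d\<close>. The transpose of the embedded adjoint is the required
  factor.\<close>

lemma square_matrix_factor:
  fixes f :: "'a::euclidean_space \<Rightarrow> real^'d" and S :: "real^'d^'d"
  assumes f: "linear f" and S: "\<And>y. f (adjoint f y) = S *v y"
  obtains A :: "real^'d^'d" where "A ** transpose A = S"
proof -
  have adj: "linear (adjoint f)" by (rule adjoint_linear[OF f])
  have "dim (range (adjoint f)) \<le> dim (UNIV :: (real^'d) set)"
    by (rule dim_image_le[OF adj])
  then obtain j :: "'a \<Rightarrow> real^'d" where j: "linear j" "\<And>x. x \<in> range (adjoint f) \<Longrightarrow> norm (j x) = norm x"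
    using isometry_subset_subspace[of "range (adjoint f)" UNIV] adj
    by (metis linear_subspace_image subspace_UNIV)
  define p where "p = j \<circ> adjoint f"
  have p: "linear p" unfolding p_def using adj j(1) by (rule linear_compose)
  define A where "A = transpose (matrix p)"
  have Ap: "transpose A *v y = p y" for y
    unfolding A_def using p by (simp add: matrix_works)
  have "x \<bullet> ((A ** transpose A) *v y) = x \<bullet> (S *v y)" for x y
  proof -
    have "x \<bullet> ((A ** transpose A) *v y) = p x \<bullet> p y"
      by (metis Ap inner_commute inner_matrix_vector_left matrix_vector_mul_assoc)
    also have "\<dots> = adjoint f x \<bullet> adjoint f y"
      unfolding p_def o_def
      using inner_eq_if_norm_eq[of "j \<circ> adjoint f" "adjoint f"] adj linear_compose[OF adj j(1)] j(2)
      by simp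
    also have "\<dots> = x \<bullet> (S *v y)"
      by (metis S adjoint_works f inner_commute)
    finally show ?thesis .
  qed
  then have "A ** transpose A = S"
    by (metis matrix_eq vector_eq_ldot)
  then show thesis by (rule that)
qed

lemma norm_adjoint_eq_sqrt:
  fixes f :: "'a::euclidean_space \<Rightarrow> real^'d"
  assumes f: "linear f" and S: "\<And>y. f (adjoint f y) = S *v y"
  shows "norm (adjoint f y) = sqrt (y \<bullet> (S *v y))"
  by (metis S f inner_commute norm_adjoint_power2 norm_ge_zero real_sqrt_unique)

text \<open>A square factor exists, so the choice in \<open>normal_law\<close> is a genuine one; any
  two maps with the same covariance give the same law, so its outcome is immaterial.\<close>

lemma normal_law_eq_distr:
  fixes f :: "'a::euclidean_space \<Rightarrow> real^'d" and S :: "real^'d^'d"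
  assumes f: "linear f" and S: "\<And>y. f (adjoint f y) = S *v y"
  shows "normal_law 0 S = distr gauss borel f"
proof -
  define A :: "real^'d^'d" where "A = (SOME A. A ** transpose A = S)"
  have "\<exists>A::real^'d^'d. A ** transpose A = S"
    using square_matrix_factor[OF f S] by metis
  then have A: "A ** transpose A = S"
    unfolding A_def by (rule someI_ex)
  have "normal_law 0 S = distr gauss borel ((*v) A)"
    by (simp add: normal_law_def std_normal_eq_gauss flip: A_def)
  also have "\<dots> = distr gauss borel f"
  proof (rule distr_gauss_eqI[OF matrix_vector_mul_linear f])
    fix y
    have "A *v (adjoint ((*v) A) y) = S *v y" for y
      by (simp add: adjoint_matrix matrix_vector_mul_assoc A)
    then show "norm (adjoint ((*v) A) y) = norm (adjoint f y)"
      using norm_adjoint_eq_sqrt[OF matrix_vector_mul_linear, of A S] norm_adjoint_eq_sqrt[OF f S] by simp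
  qed
  finally show ?thesis .
qed

lemma normal_law_eq_distr_matrix:
  fixes A :: "real^'n^'d"
  assumes "A ** transpose A = S"
  shows "normal_law 0 S = distr gauss borel ((*v) A)"
  using assms by (intro normal_law_eq_distr) (simp_all add: adjoint_matrix matrix_vector_mul_assoc)

text \<open>Adding independent noise, seen as a linear map on the product space; there
  \<open>gauss_pair\<close> makes the pair of generating vectors one standard Gaussian.\<close>

definition noise_map :: "real^'n^'d \<Rightarrow> real \<Rightarrow> (real^'n) \<times> (real^'d) \<Rightarrow> real^'d" where
  "noise_map A s p = A *v fst p + s *\<^sub>R snd p"

lemma linear_noise_map: "linear (noise_map A s)"
  by (auto simp: linear_iff noise_map_def algebra_simps)

lemma noise_map_adjoint:
  "noise_map A s (adjoint (noise_map A s) y) = (A ** transpose A + s\<^sup>2 *\<^sub>R mat 1) *v y"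
proof -
  have "adjoint (noise_map A s) = (\<lambda>y. (transpose A *v y, s *\<^sub>R y))"
    by (rule adjoint_unique) (simp add: noise_map_def inner_prod_def inner_simps inner_matrix_vector_left)
  then show ?thesis
    by (simp add: noise_map_def matrix_vector_mul_assoc matrix_vector_mult_add_rdistrib power2_eq_square
        flip: scaleR_matrix_vector_assoc)
qed

lemma add_noise_distr:
  fixes A :: "real^'n^'d"
  shows "add_noise s (distr gauss borel ((*v) A)) = normal_law 0 (A ** transpose A + s\<^sup>2 *\<^sub>R mat 1)"
proof -
  have [measurable]: "(*v) A \<in> borel_measurable borel"
    by (simp add: linear_borel_measurable)
  have "normal_law 0 (A ** transpose A + s\<^sup>2 *\<^sub>R mat 1) = distr gauss borel (noise_map A s)"
    by (rule normal_law_eq_distr[OF linear_noise_map noise_map_adjoint])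
  also have "\<dots> = distr (distr gauss borel ((*v) A) \<Otimes>\<^sub>M gauss) borel (\<lambda>(x, e). x + s *\<^sub>R e)"
  proof -
    interpret G: prob_space "gauss :: (real^'d) measure" by (rule prob_space_gauss)
    interpret H: prob_space "gauss :: (real^'n) measure" by (rule prob_space_gauss)
    have "distr gauss borel ((*v) A) \<Otimes>\<^sub>M distr gauss borel (\<lambda>x. x)
        = distr (gauss \<Otimes>\<^sub>M gauss) (borel \<Otimes>\<^sub>M borel) (\<lambda>(x, y). (A *v x, y :: real^'d))"
      by (intro pair_measure_distr prob_space_imp_sigma_finite G.prob_space_distr) simp_all
    moreover have "distr gauss borel (\<lambda>x. x) = (gauss :: (real^'d) measure)"
      by (rule distr_id2) simp
    ultimately have "distr (distr gauss borel ((*v) A) \<Otimes>\<^sub>M gauss) borel (\<lambda>(x, e). x + s *\<^sub>R e)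
        = distr (distr (gauss \<Otimes>\<^sub>M gauss) (borel \<Otimes>\<^sub>M borel) (\<lambda>(x, y). (A *v x, y :: real^'d))) borel (\<lambda>(x, e). x + s *\<^sub>R e)"
      by simp
    also have "\<dots> = distr (gauss \<Otimes>\<^sub>M gauss) borel (noise_map A s)"
      by (subst distr_distr) (simp_all add: o_def noise_map_def[abs_def] case_prod_beta')
    finally show ?thesis by (simp add: gauss_pair)
  qed
  finally show ?thesis
    by (simp add: add_noise_def std_normal_eq_gauss)
qed

subsection \<open>Second moments\<close>

lemma nn_integral_std_normal_square: "(\<integral>\<^sup>+x. ennreal (std_normal_density x * x\<^sup>2) \<partial>lborel) = 1"
  using std_normal_moment_even[of 1]
  by (subst nn_integral_eq_integral)
    (auto simp: has_bochner_integral_iff normal_density_nonneg)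

lemma nn_integral_gauss_Basis:
  fixes e :: "'a::euclidean_space"
  assumes e: "e \<in> Basis"
  shows "(\<integral>\<^sup>+z. ennreal ((z \<bullet> e)\<^sup>2) \<partial>gauss) = 1"
proof -
  \<comment> \<open>The square is absorbed into the factor of the coordinate \<open>e\<close>, so
    that the integral factorizes over the coordinates.\<close>
  define f :: "'a \<Rightarrow> real \<Rightarrow> ennreal"
    where "f = (\<lambda>b t. ennreal (std_normal_density t * (if b = e then t\<^sup>2 else 1)))"
  have "(\<integral>\<^sup>+z. ennreal ((z \<bullet> e)\<^sup>2) \<partial>gauss) = (\<integral>\<^sup>+z. (\<Prod>b\<in>Basis. f b (z \<bullet> b)) \<partial>lborel)"
    unfolding gauss_def f_def using e
    by (subst nn_integral_density)
      (auto intro!: nn_integral_cong simp: prod_ennreal normal_density_nonneg prod.distrib prod.delta prod_nonneg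
        simp flip: ennreal_mult)
  also have "\<dots> = (\<Prod>b\<in>Basis. \<integral>\<^sup>+t. f b t \<partial>lborel)"
    by (rule nn_integral_lborel_prod) (simp_all add: f_def)
  also have "\<dots> = 1"
  proof (intro prod.neutral ballI)
    fix b :: 'a
    show "(\<integral>\<^sup>+t. f b t \<partial>lborel) = 1"
      by (cases "b = e")
        (simp_all add: f_def nn_integral_std_normal_square nn_integral_eq_integral normal_density_nonneg)
  qed
  finally show ?thesis .
qed

text \<open>By rotation invariance \<open>b \<bullet> z\<close> has the law of \<open>\<parallel>b\<parallel>\<close> times a coordinate, so no mixed moments are needed.\<close>

lemma nn_integral_gauss_inner:
  fixes b :: "'a::euclidean_space"
  shows "(\<integral>\<^sup>+z. ennreal ((b \<bullet> z)\<^sup>2) \<partial>gauss) = ennreal ((norm b)\<^sup>2)"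
proof -
  obtain e :: 'a where e: "e \<in> Basis" using nonempty_Basis by blast
  define g where "g = (\<lambda>z::'a. norm b * (z \<bullet> e))"
  have f: "linear ((\<bullet>) b)" and g: "linear g"
    unfolding g_def by (auto simp: linear_iff inner_simps algebra_simps)
  have [measurable]: "(\<bullet>) b \<in> borel_measurable borel" "g \<in> borel_measurable borel"
    using f g by (simp_all add: linear_borel_measurable)
  have "adjoint ((\<bullet>) b) = (\<lambda>y. y *\<^sub>R b)"
    by (rule adjoint_unique) (simp add: inner_commute)
  moreover have "adjoint g = (\<lambda>y. (norm b * y) *\<^sub>R e)"
    unfolding g_def by (rule adjoint_unique) simp
  ultimately have "distr gauss borel ((\<bullet>) b) = distr gauss borel g"
    using e by (intro distr_gauss_eqI f g) (simp add: abs_mult)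
  then have "(\<integral>\<^sup>+t. ennreal (t\<^sup>2) \<partial>distr gauss borel ((\<bullet>) b)) = (\<integral>\<^sup>+t. ennreal (t\<^sup>2) \<partial>distr gauss borel g)"
    by simp
  then have "(\<integral>\<^sup>+z. ennreal ((b \<bullet> z)\<^sup>2) \<partial>gauss) = (\<integral>\<^sup>+z. ennreal ((g z)\<^sup>2) \<partial>gauss)"
    by (simp add: nn_integral_distr)
  also have "\<dots> = (\<integral>\<^sup>+z. ennreal ((norm b)\<^sup>2) * ennreal ((z \<bullet> e)\<^sup>2) \<partial>gauss)"
    by (simp add: g_def power_mult_distrib flip: ennreal_mult)
  also have "\<dots> = ennreal ((norm b)\<^sup>2)"
    by (subst nn_integral_cmult) (simp_all add: nn_integral_gauss_Basis[OF e])
  finally show ?thesis .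
qed

lemma norm_vec_power2: "(norm (x :: ('a::real_normed_vector)^'n))\<^sup>2 = (\<Sum>i\<in>UNIV. (norm (x $ i))\<^sup>2)"
  by (simp add: norm_vec_def L2_set_def sum_nonneg)

text \<open>Each coordinate of \<open>B *v z\<close> is the inner product of \<open>z\<close> with a
  row, and the squared row norms add up to the square of \<open>norm B\<close>, which is the
  Frobenius norm.\<close>

lemma nn_integral_gauss_matrix:
  fixes B :: "real^'n^'m"
  shows "(\<integral>\<^sup>+z. ennreal ((norm (B *v z))\<^sup>2) \<partial>gauss) = ennreal ((norm B)\<^sup>2)"
proof -
  have "ennreal ((norm (B *v z))\<^sup>2) = (\<Sum>i\<in>UNIV. ennreal ((B $ i \<bullet> z)\<^sup>2))" for z
    unfolding norm_vec_power2[of "B *v z"] by (subst sum_ennreal) (simp_all add: matrix_vector_mul_component)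
  then have "(\<integral>\<^sup>+z. ennreal ((norm (B *v z))\<^sup>2) \<partial>gauss) = (\<Sum>i\<in>UNIV. ennreal ((norm (B $ i))\<^sup>2))"
    by (simp only:) (simp add: nn_integral_sum nn_integral_gauss_inner del: sum_ennreal)
  also have "\<dots> = ennreal ((norm B)\<^sup>2)"
    unfolding norm_vec_power2[of B] by (rule sum_ennreal) simp
  finally show ?thesis .
qed

lemma norm_matrix_power2:
  fixes A :: "real^'n^'m"
  shows "(norm A)\<^sup>2 = trace (A ** transpose A)"
  unfolding norm_vec_power2[of A]
  by (simp add: trace_def matrix_mult_transpose_dot_row row_def power2_norm_eq_inner)

subsection \<open>Score of a nondegenerate Gaussian\<close>

text \<open>Two continuous densities of one measure agree almost everywhere; the set where they
  differ is open and null, hence empty.\<close>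

lemma continuous_density_eqI:
  fixes f :: "real^'n \<Rightarrow> real"
  assumes f: "continuous_on UNIV f" "\<And>x. 0 \<le> f x" and M: "M = density lborel (\<lambda>x. ennreal (f x))"
  shows "continuous_density M = f"
  unfolding continuous_density_def
proof (rule the_equality)
  fix g assume g: "continuous_on UNIV g \<and> (\<forall>x. 0 \<le> g x) \<and> M = density lborel (\<lambda>x. ennreal (g x))"
  have [measurable]: "f \<in> borel_measurable borel" "g \<in> borel_measurable borel"
    using f g by (auto intro: borel_measurable_continuous_onI)
  have "M = density lborel (\<lambda>x. ennreal (g x))"
    using g by blast
  from this[symmetric] M have "density lborel (\<lambda>x. ennreal (g x)) = density lborel (\<lambda>x. ennreal (f x))"
    by (rule trans)
  then have "AE x in lborel. ennreal (g x) = ennreal (f x)"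
    by (rule sigma_finite_measure.density_unique_iff[OF sigma_finite_lborel, THEN iffD1, rotated 2]) measurable
  then have ae: "AE x in lborel. g x = f x"
    using f g by simp
  have op: "open {x. g x \<noteq> f x}"
    using f(1) g by (intro open_Collect_neq) auto
  have "emeasure lborel {x. g x \<noteq> f x} = 0"
    using ae by (subst (asm) AE_iff_measurable[OF _ refl]) auto
  then have "{x. g x \<noteq> f x} = {}"
    using emeasure_lborel_open_pos[OF op] by force
  then show "g = f" by auto
qed (use assms in auto)

lemma score_eqI:
  fixes f :: "real^'n \<Rightarrow> real"
  assumes "continuous_on UNIV f" "\<And>x. 0 \<le> f x" "M = density lborel (\<lambda>x. ennreal (f x))"
    and "GDERIV (\<lambda>y. ln (f y)) x :> g"
  shows "score M x = g"
  unfolding score_def continuous_density_eqI[OF assms(1-3)]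
proof (rule the_equality)
  fix h assume "GDERIV (\<lambda>y. ln (f y)) x :> h"
  then have "(\<lambda>k. k \<bullet> h) = (\<lambda>k. k \<bullet> g)"
    using assms(4) unfolding gderiv_def by (rule has_derivative_unique)
  then show "h = g" by (metis vector_eq_ldot)
qed (rule assms(4))

text \<open>The Jacobian and the normalizing factor are merged into an unspecified constant
  \<open>C\<close>, which disappears when the logarithm is differentiated.\<close>

lemma distr_gauss_matrix_density:
  fixes A B :: "real^'n^'n"
  assumes AB: "A ** B = mat 1" "B ** A = mat 1"
  obtains C where "C > 0" "distr gauss borel ((*v) A)
    = density lborel (\<lambda>x. ennreal (C * exp (- (norm (B *v x))\<^sup>2 / 2)))"
proof -
  have bij: "bij ((*v) A)"
    by (rule o_bij[of "(*v) B"]) (auto simp: fun_eq_iff matrix_vector_mul_assoc AB)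
  have [measurable]: "(*v) A \<in> borel_measurable borel" "(*v) B \<in> borel_measurable borel"
    by (simp_all add: linear_borel_measurable)
  obtain c where c: "c > 0" "distr lborel borel ((*v) A) = density lborel (\<lambda>_. ennreal c)"
    using distr_lborel_linear[OF matrix_vector_mul_linear bij] by metis
  define k where "k = (1 / sqrt (2 * pi)) ^ DIM(real^'n)"
  have k: "k > 0" by (simp add: k_def)
  have "distr gauss borel ((*v) A) = density (distr lborel borel ((*v) A)) (\<lambda>x. ennreal (k * exp (- (norm (B *v x))\<^sup>2 / 2)))"
    unfolding gauss_def prod_std_normal_density k_def
    by (subst density_distr) (simp_all add: matrix_vector_mul_assoc AB)
  also have "\<dots> = density lborel (\<lambda>x. ennreal ((c * k) * exp (- (norm (B *v x))\<^sup>2 / 2)))"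
    unfolding c(2) using c(1) k
    by (subst density_density_eq) (simp_all add: mult.assoc flip: ennreal_mult)
  finally show thesis using that[of "c * k"] c(1) k by simp
qed

text \<open>With \<open>B\<close> the inverse of \<open>A\<close>, the log density is a constant
  minus half the squared norm of \<open>B *v x\<close>. Its gradient is minus
  \<open>transpose B ** B\<close> applied to \<open>x\<close>, and this product is the inverse
  \<open>X\<close> of the covariance.\<close>

lemma score_distr_gauss:
  fixes A X :: "real^'n^'n"
  assumes inv: "A ** transpose A ** X = mat 1"
  shows "score (distr gauss borel ((*v) A)) x = - (X *v x)"
proof -
  define B where "B = transpose A ** X"
  have AB: "A ** B = mat 1" using inv by (simp add: B_def matrix_mul_assoc)
  then have BA: "B ** A = mat 1" by (simp add: matrix_left_right_inverse)
  have "transpose B ** transpose A = mat 1"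
    using AB by (simp flip: matrix_transpose_mul)
  then have X: "transpose B ** B = X"
    by (simp add: B_def matrix_mul_assoc)
  obtain C where C: "C > 0" "distr gauss borel ((*v) A)
      = density lborel (\<lambda>x. ennreal (C * exp (- (norm (B *v x))\<^sup>2 / 2)))"
    using distr_gauss_matrix_density[OF AB BA] by metis
  show ?thesis
  proof (rule score_eqI[OF _ _ C(2)])
    have ln: "(\<lambda>y. ln (C * exp (- (norm (B *v y))\<^sup>2 / 2))) = (\<lambda>y. ln C - (1 / 2) * ((B *v y) \<bullet> (B *v y)))"
      using C(1) by (simp add: ln_mult power2_norm_eq_inner)
    have B: "bounded_linear ((*v) B)"
      by (simp add: linear_conv_bounded_linear[symmetric])
    have "(B *v h) \<bullet> (B *v x) = h \<bullet> (X *v x)" for h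
      using inner_matrix_vector_left[of B h "B *v x"] by (simp only: matrix_vector_mul_assoc X)
    then have eq: "(\<lambda>h. - ((B *v h) \<bullet> (B *v x))) = (\<lambda>h. h \<bullet> - (X *v x))"
      by simp
    have dB: "((*v) B has_derivative (*v) B) (at x)"
      by (rule bounded_linear_imp_has_derivative[OF B])
    have "((\<lambda>y. ln C - (1 / 2) * ((B *v y) \<bullet> (B *v y))) has_derivative
        (\<lambda>h. 0 - (1 / 2) * ((B *v x) \<bullet> (B *v h) + (B *v h) \<bullet> (B *v x)))) (at x)"
      by (intro has_derivative_diff has_derivative_const has_derivative_mult_right has_derivative_inner dB)
    also have "(\<lambda>h. 0 - (1 / 2) * ((B *v x) \<bullet> (B *v h) + (B *v h) \<bullet> (B *v x)))
        = (\<lambda>h. - ((B *v h) \<bullet> (B *v x)))"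
      by (simp add: fun_eq_iff inner_commute[of "B *v x"])
    finally have "((\<lambda>y. ln C - (1 / 2) * ((B *v y) \<bullet> (B *v y))) has_derivative (\<lambda>h. - ((B *v h) \<bullet> (B *v x)))) (at x)" .
    then show "GDERIV (\<lambda>y. ln (C * exp (- (norm (B *v y))\<^sup>2 / 2))) x :> - (X *v x)"
      unfolding gderiv_def ln eq .
  next
    have "continuous_on UNIV ((*v) B)"
      by (intro linear_continuous_on) (simp add: linear_conv_bounded_linear[symmetric])
    then show "continuous_on UNIV (\<lambda>x. C * exp (- (norm (B *v x))\<^sup>2 / 2))"
      by (intro continuous_intros) simp_all
  qed (use C(1) in simp)
qed

subsection \<open>Matrix algebra\<close>

lemma matrix_add_rdistrib': "((A::real^'n^'m) + B) ** C = A ** C + B ** C"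
  by (vector matrix_matrix_mult_def sum.distrib[symmetric] field_simps)

lemma matrix_diff_ldistrib: "(A::real^'n^'m) ** (B - C) = A ** B - A ** C"
  by (vector matrix_matrix_mult_def sum_subtractf[symmetric] field_simps)

lemma matrix_diff_rdistrib: "((A::real^'n^'m) - B) ** C = A ** C - B ** C"
  by (vector matrix_matrix_mult_def sum_subtractf[symmetric] field_simps)

lemma transpose_add: "transpose (A + B) = transpose A + transpose (B::real^'n^'m)"
  and transpose_diff: "transpose (A - B) = transpose A - transpose (B::real^'n^'m)"
  by (simp_all add: transpose_def vec_eq_iff)

lemma trace_scaleR: "trace (c *\<^sub>R (A::real^'n^'n)) = c * trace A"
  by (simp add: trace_def sum_distrib_left)

lemmas matrix_algebra = matrix_add_ldistrib matrix_add_rdistrib' matrix_diff_ldistrib matrix_diff_rdistrib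
  matrix_scalar_ac scalar_matrix_assoc[symmetric] matrix_mul_assoc
  transpose_add transpose_diff transpose_scalar matrix_transpose_mul

text \<open>Splits the trace over the rows of \<open>B\<close>, so that bounds on the quadratic form
  of \<open>N\<close> carry over to it.\<close>

lemma trace_conjugate:
  fixes B :: "real^'n^'m"
  shows "trace (B ** N ** transpose B) = (\<Sum>i\<in>UNIV. B $ i \<bullet> (N *v B $ i))"
proof -
  have "(B ** N ** transpose B) $ i $ i = B $ i \<bullet> (N *v B $ i)" for i
  proof -
    have "(B ** N ** transpose B) $ i $ i = (B ** (N ** transpose B)) $ i $ i"
      by (simp add: matrix_mul_assoc)
    also have "\<dots> = B $ i \<bullet> (N *v B $ i)"
      by (simp add: matrix_matrix_mult_def inner_vec_def matrix_vector_mult_def transpose_def)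
    finally show ?thesis .
  qed
  then show ?thesis by (simp add: trace_def)
qed

text \<open>Expand the nonnegative quadratic form of \<open>K\<close> at
  \<open>N *v x - (1 / k) *\<^sub>R x\<close> and bound its last term by the hypothesis on
  \<open>k\<close>.\<close>

lemma inverse_quadratic_form_ge:
  fixes K N :: "real^'n^'n"
  assumes sym: "transpose K = K" and KN: "K ** N = mat 1" and k: "k > 0"
    and pos: "\<And>x. 0 \<le> x \<bullet> (K *v x)" and le: "\<And>x. x \<bullet> (K *v x) \<le> k * (norm x)\<^sup>2"
  shows "(norm x)\<^sup>2 / k \<le> x \<bullet> (N *v x)"
proof -
  define y where "y = N *v x - (1 / k) *\<^sub>R x"
  have KNx: "K *v (N *v x) = x" by (simp add: matrix_vector_mul_assoc KN)
  have Kl: "(N *v x) \<bullet> (K *v x) = x \<bullet> x"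
    using inner_matrix_vector_left[of K "N *v x" x] KNx by (simp add: sym)
  have "0 \<le> y \<bullet> (K *v y)" by (rule pos)
  also have "y \<bullet> (K *v y) = x \<bullet> (N *v x) - 2 / k * (x \<bullet> x) + (1 / k)\<^sup>2 * (x \<bullet> (K *v x))"
    by (simp add: y_def algebra_simps KNx Kl inner_simps power2_eq_square inner_commute[of "N *v x" x])
  also have "\<dots> \<le> x \<bullet> (N *v x) - 2 / k * (x \<bullet> x) + (1 / k)\<^sup>2 * (k * (norm x)\<^sup>2)"
    by (intro add_left_mono mult_left_mono le) simp
  also have "\<dots> = x \<bullet> (N *v x) - (norm x)\<^sup>2 / k"
    using k by (simp add: power2_eq_square[of k] power_divide field_simps flip: power2_norm_eq_inner)
  finally show ?thesis by simp
qed

lemma projection_facts: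
  fixes E :: "real^'r^'d"
  assumes E: "transpose E ** E = mat 1"
  shows "E ** transpose E ** (E ** transpose E) = E ** transpose E"
    and "trace (E ** transpose E) = real CARD('r)"
proof -
  show "E ** transpose E ** (E ** transpose E) = E ** transpose E"
    by (metis E matrix_mul_assoc matrix_mul_rid)
  show "trace (E ** transpose E) = real CARD('r)"
    by (subst trace_mul_sym) (simp add: E trace_I)
qed

lemma matrix_inv_eqI:
  fixes A B :: "real^'n^'n"
  assumes "A ** B = mat 1"
  shows "matrix_inv A = B"
proof -
  have "B ** A = mat 1" using assms by (simp add: matrix_left_right_inverse)
  then have "invertible A" using assms unfolding invertible_def by blast
  then have "matrix_inv A ** A = mat 1"
    unfolding matrix_inv_def invertible_def by (rule someI2_ex) blast
  then show ?thesis
    by (metis assms matrix_mul_assoc matrix_mul_lid matrix_mul_rid)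
qed

text \<open>\<open>P\<close> and \<open>mat 1 - P\<close> are idempotents with product 0, so their
  coefficients multiply separately.\<close>

lemma projection_combination_inverse:
  fixes P :: "real^'d^'d"
  assumes P: "P ** P = P" and ab: "a \<noteq> 0" "b \<noteq> 0"
  shows "(a *\<^sub>R P + b *\<^sub>R (mat 1 - P)) ** ((1 / a) *\<^sub>R P + (1 / b) *\<^sub>R (mat 1 - P)) = mat 1"
  using ab by (simp add: matrix_algebra P scaleR_right_diff_distrib scaleR_right_distrib)

subsection \<open>The loss at a fixed noise level\<close>

locale noise_level =
  fixes E :: "real^'r^'d" and \<sigma> s :: real and U V :: "real^'r^'d"
  assumes E: "transpose E ** E = mat 1" and \<sigma>: "\<sigma> > 0" and s: "s > 0"
    and U: "transpose U ** U = mat 1" and pd: "positive_definite (transpose V ** V)"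
begin

text \<open>\<open>S\<close> is the covariance of the noised generator and \<open>X\<close> its
  inverse: on the range of \<open>U\<close> it acts as \<open>N\<close>, on the orthogonal
  complement only noise is left. \<open>M\<close> is the inverse covariance of the noised data, so
  the two scores differ by the linear map \<open>X - M\<close>. \<open>H\<close> is the deviation of
  \<open>W\<close> from its optimal value.\<close>

definition P where "P = E ** transpose E"
definition W where "W = transpose V ** V"
definition K where "K = W + s\<^sup>2 *\<^sub>R mat 1"
definition N where "N = matrix_inv K"
definition S where "S = U ** W ** transpose U + s\<^sup>2 *\<^sub>R mat 1"
definition X where "X = U ** N ** transpose U + (1 / s\<^sup>2) *\<^sub>R (mat 1 - U ** transpose U)"
definition \<alpha> where "\<alpha> = 1 / (1 + \<sigma>\<^sup>2 + s\<^sup>2)"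
definition \<beta> where "\<beta> = 1 / (\<sigma>\<^sup>2 + s\<^sup>2)"
definition M where "M = \<alpha> *\<^sub>R P + \<beta> *\<^sub>R (mat 1 - P)"
definition H where "H = W - (1 + \<sigma>\<^sup>2) *\<^sub>R mat 1"

text \<open>Stated with a left factor \<open>A\<close> because \<open>matrix_mul_assoc\<close>
  brackets products to the left; \<open>AWN\<close> has its form for the same reason.\<close>

lemma U': "A ** transpose U ** U = A"
  by (metis U matrix_mul_assoc matrix_mul_rid)

lemma P [simp]: "P ** P = P" "transpose P = P" "trace P = real CARD('r)"
  using projection_facts[OF E] by (simp_all add: P_def matrix_transpose_mul)

lemma W_sym: "transpose W = W"
  by (simp add: W_def matrix_transpose_mul)

lemma K_sym: "transpose K = K"
  by (simp add: K_def W_sym matrix_algebra)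

lemma inner_K: "x \<bullet> (K *v x) = (norm (V *v x))\<^sup>2 + s\<^sup>2 * (norm x)\<^sup>2"
proof -
  have "x \<bullet> (W *v x) = (norm (V *v x))\<^sup>2"
    by (simp add: W_def inner_matrix_vector_left power2_norm_eq_inner flip: matrix_vector_mul_assoc)
  then show ?thesis
    by (simp add: K_def matrix_vector_mult_add_rdistrib inner_add_right power2_norm_eq_inner
        flip: scaleR_matrix_vector_assoc)
qed

text \<open>The noise term bounds the quadratic form of \<open>K\<close> below by
  \<open>s\<^sup>2 * (norm x)\<^sup>2\<close>, so \<open>K\<close> is injective.\<close>

lemma KN: "K ** N = mat 1"
proof -
  have "x = 0" if "K *v x = 0" for x
  proof -
    have "s\<^sup>2 * (norm x)\<^sup>2 \<le> x \<bullet> (K *v x)" by (simp add: inner_K)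
    then show "x = 0" using that s by (simp add: mult_le_0_iff)
  qed
  then obtain B where "B ** K = mat 1"
    using matrix_left_invertible_ker[of K] by blast
  then have "K ** B = mat 1" by (simp add: matrix_left_right_inverse)
  then show ?thesis unfolding N_def by (simp add: matrix_inv_eqI)
qed

lemma NK: "N ** K = mat 1"
  using KN by (simp add: matrix_left_right_inverse)

lemma N_sym: "transpose N = N"
proof -
  have "transpose N ** K = mat 1"
    using KN by (metis K_sym matrix_transpose_mul transpose_mat)
  then show ?thesis
    by (metis KN matrix_mul_assoc matrix_mul_lid matrix_mul_rid)
qed

lemma WN: "W ** N = mat 1 - s\<^sup>2 *\<^sub>R N"
  using KN by (simp add: K_def matrix_algebra algebra_simps)

lemma AWN: "A ** W ** N = A - s\<^sup>2 *\<^sub>R (A ** N)"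
  by (simp add: WN matrix_diff_ldistrib matrix_scalar_ac flip: matrix_mul_assoc scalar_matrix_assoc)

lemma SX: "S ** X = mat 1"
  using s by (simp add: S_def X_def matrix_algebra U' AWN scaleR_right_diff_distrib scaleR_right_distrib)

lemma X_sym: "transpose X = X"
  by (simp add: X_def matrix_algebra N_sym)

lemma M_sym: "transpose M = M"
  by (simp add: M_def matrix_algebra)

lemma M_inv: "matrix_inv (P + (\<sigma>\<^sup>2 + s\<^sup>2) *\<^sub>R mat 1) = M"
proof (rule matrix_inv_eqI)
  have "P + (\<sigma>\<^sup>2 + s\<^sup>2) *\<^sub>R mat 1 = (1 + \<sigma>\<^sup>2 + s\<^sup>2) *\<^sub>R P + (\<sigma>\<^sup>2 + s\<^sup>2) *\<^sub>R (mat 1 - P)"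
    by (simp add: algebra_simps)
  moreover have "1 + \<sigma>\<^sup>2 + s\<^sup>2 \<noteq> 0" "\<sigma>\<^sup>2 + s\<^sup>2 \<noteq> 0"
    using s by (auto simp: add_nonneg_eq_0_iff sum_power2_eq_zero_iff intro!: pos_add_strict less_imp_neq[symmetric] add_pos_nonneg add_nonneg_pos)
  ultimately show "(P + (\<sigma>\<^sup>2 + s\<^sup>2) *\<^sub>R mat 1) ** M = mat 1"
    by (simp add: M_def \<alpha>_def \<beta>_def projection_combination_inverse)
qed

section \<open>Traces of the matrices in the score error\<close>

lemma trace_X: "trace X = trace N + (real CARD('d) - real CARD('r)) / s\<^sup>2"
proof -
  have "trace (U ** N ** transpose U) = trace N"
    by (subst trace_mul_sym) (simp add: matrix_mul_assoc U)
  then show ?thesis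
    by (simp add: X_def trace_add trace_sub trace_scaleR trace_I projection_facts(2)[OF U])
qed

lemma trace_M: "trace M = \<alpha> * real CARD('r) + \<beta> * (real CARD('d) - real CARD('r))"
  by (simp add: M_def trace_add trace_sub trace_scaleR trace_I)

lemma trace_UWU: "trace (U ** W ** transpose U) = trace W"
  by (subst trace_mul_sym) (simp add: matrix_mul_assoc U)

lemma trace_K: "trace K = trace W + s\<^sup>2 * real CARD('r)"
  by (simp add: K_def trace_add trace_scaleR trace_I)

text \<open>Measures how far the generator leaves the range of \<open>E\<close>. Cyclicity of the
  trace merges the two copies of the idempotent \<open>mat 1 - P\<close>.\<close>

lemma defect: "(norm ((mat 1 - P) ** (U ** transpose V)))\<^sup>2 = trace W - trace (P ** (U ** W ** transpose U))"
proof -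
  have "(norm ((mat 1 - P) ** (U ** transpose V)))\<^sup>2
      = trace ((mat 1 - P) ** (U ** W ** transpose U) ** (mat 1 - P))"
    by (simp add: norm_matrix_power2 W_def matrix_algebra)
  also have "\<dots> = trace ((mat 1 - P) ** ((mat 1 - P) ** (U ** W ** transpose U)))"
    by (rule trace_mul_sym)
  also have "(mat 1 - P) ** ((mat 1 - P) ** (U ** W ** transpose U))
      = U ** W ** transpose U - P ** (U ** W ** transpose U)"
    by (simp add: matrix_algebra)
  finally show ?thesis by (simp add: trace_sub trace_UWU)
qed

lemma trace_MSM: "trace (M ** S ** M) = \<alpha>\<^sup>2 * trace (P ** S) + \<beta>\<^sup>2 * (trace S - trace (P ** S))"
proof -
  have "trace (M ** S ** M) = trace (M ** M ** S)"
    by (subst trace_mul_sym) (simp add: matrix_mul_assoc)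
  also have "M ** M = \<alpha>\<^sup>2 *\<^sub>R P + \<beta>\<^sup>2 *\<^sub>R (mat 1 - P)"
    by (simp add: M_def matrix_algebra power2_eq_square algebra_simps)
  finally show ?thesis
    by (simp add: matrix_algebra trace_add trace_sub trace_scaleR)
qed

lemma trace_S: "trace S = trace W + s\<^sup>2 * real CARD('d)"
  by (simp add: S_def trace_add trace_scaleR trace_I trace_UWU)

lemma trace_PS: "trace (P ** S) = trace (P ** (U ** W ** transpose U)) + s\<^sup>2 * real CARD('r)"
  by (simp add: S_def matrix_algebra trace_add trace_scaleR)

text \<open>As \<open>\<alpha> *\<^sub>R H = \<alpha> *\<^sub>R K - mat 1\<close> and
  \<open>N\<close> is the inverse of \<open>K\<close>, the product expands to \<open>N\<close> minus
  twice \<open>\<alpha> *\<^sub>R mat 1\<close> plus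
  \<open>\<alpha>\<^sup>2 *\<^sub>R K\<close>.\<close>

lemma trace_HNH: "\<alpha>\<^sup>2 * trace (H ** N ** transpose H) = trace N - 2 * \<alpha> * real CARD('r) + \<alpha>\<^sup>2 * trace K"
proof -
  have a: "\<alpha> * (1 + \<sigma>\<^sup>2 + s\<^sup>2) = 1"
    using s unfolding \<alpha>_def by (simp add: add_pos_pos add_nonneg_pos order_less_imp_not_eq2)
  have H: "H = K - (1 + \<sigma>\<^sup>2 + s\<^sup>2) *\<^sub>R mat 1"
    by (simp add: H_def K_def algebra_simps)
  have "\<alpha> *\<^sub>R H = \<alpha> *\<^sub>R K - mat 1"
    by (simp add: H scaleR_right_diff_distrib a)
  then have "(\<alpha> *\<^sub>R H) ** N ** transpose (\<alpha> *\<^sub>R H) = (\<alpha> *\<^sub>R K - mat 1) ** N ** (\<alpha> *\<^sub>R K - mat 1)"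
    by (simp add: transpose_diff transpose_scalar K_sym)
  also have "\<dots> = N - \<alpha> *\<^sub>R mat 1 - \<alpha> *\<^sub>R mat 1 + \<alpha>\<^sup>2 *\<^sub>R K"
    by (simp add: matrix_algebra KN NK power2_eq_square scaleR_right_diff_distrib)
  finally have "\<alpha>\<^sup>2 *\<^sub>R (H ** N ** transpose H) = N - \<alpha> *\<^sub>R mat 1 - \<alpha> *\<^sub>R mat 1 + \<alpha>\<^sup>2 *\<^sub>R K"
    by (simp add: matrix_algebra power2_eq_square)
  then have "trace (\<alpha>\<^sup>2 *\<^sub>R (H ** N ** transpose H)) = trace (N - \<alpha> *\<^sub>R mat 1 - \<alpha> *\<^sub>R mat 1 + \<alpha>\<^sup>2 *\<^sub>R K)"
    by simp
  then show ?thesis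
    by (simp only: trace_add trace_sub trace_scaleR trace_I)
qed

text \<open>Since \<open>X\<close> inverts \<open>S\<close>, the product expands to
  \<open>X - M - M + M ** S ** M\<close>. In the trace, the contributions of \<open>N\<close>,
  \<open>K\<close> and \<open>\<alpha>\<close> form the \<open>H\<close> term, those weighted by the
  codimension complete a square, and the rest is the defect.\<close>

lemma trace_score_error:
  "trace ((X - M) ** S ** (X - M)) = (real CARD('d) - real CARD('r)) * s\<^sup>2 * (1 / s\<^sup>2 - \<beta>)\<^sup>2
    + \<alpha>\<^sup>2 * trace (H ** N ** transpose H)
    + (\<beta>\<^sup>2 - \<alpha>\<^sup>2) * (norm ((mat 1 - P) ** (U ** transpose V)))\<^sup>2"
proof -
  have XS: "X ** S = mat 1" using SX by (simp add: matrix_left_right_inverse)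
  have "M ** S ** X = M" by (metis SX matrix_mul_assoc matrix_mul_rid)
  then have "(X - M) ** S ** (X - M) = X - M - M + M ** S ** M"
    by (simp add: matrix_algebra XS algebra_simps)
  then have "trace ((X - M) ** S ** (X - M)) = trace X - trace M - trace M + trace (M ** S ** M)"
    by (simp only: trace_add trace_sub)
  moreover have "(real CARD('d) - real CARD('r)) * s\<^sup>2 * (1 / s\<^sup>2 - \<beta>)\<^sup>2
      = (real CARD('d) - real CARD('r)) / s\<^sup>2 - 2 * \<beta> * (real CARD('d) - real CARD('r))
        + \<beta>\<^sup>2 * s\<^sup>2 * (real CARD('d) - real CARD('r))"
    using s by (simp add: power2_diff power_divide field_simps power2_eq_square)
  ultimately show ?thesis
    unfolding trace_HNH trace_MSM trace_X trace_M trace_S trace_PS trace_K defect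
    by (simp add: algebra_simps)
qed

end

lemma generator_law_eq: "generator_law (U, V) = distr gauss borel ((*v) (U ** transpose V))"
  by (simp add: generator_law_def generator_def std_normal_eq_gauss)

section \<open>Expected score error at one noise level and its lower bound\<close>

context noise_level
begin

lemma S_eq: "S = (U ** transpose V) ** transpose (U ** transpose V) + s\<^sup>2 *\<^sub>R mat 1"
  by (simp add: S_def W_def matrix_transpose_mul matrix_mul_assoc)

text \<open>With a square factor \<open>A\<close> of \<open>S\<close>, the noised law is that of
  \<open>A *v z\<close> and the score difference there is \<open>((X - M) ** A) *v z\<close>; its
  second moment is a squared Frobenius norm, that is, the trace.\<close>

lemma expected_score_error:
  "(\<integral>\<^sup>+ x. ennreal ((norm (data_score E \<sigma> s x - score (add_noise s (generator_law (U, V))) x))\<^sup>2)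
      \<partial>(add_noise s (generator_law (U, V)))) = ennreal (trace ((X - M) ** S ** (X - M)))"
proof -
  obtain A :: "real^'d^'d" where A: "A ** transpose A = S"
    using square_matrix_factor[OF linear_noise_map noise_map_adjoint] unfolding S_eq by blast
  have law: "add_noise s (generator_law (U, V)) = distr gauss borel ((*v) A)"
    by (simp add: generator_law_eq add_noise_distr normal_law_eq_distr_matrix[OF A] flip: S_eq)
  have sc: "score (distr gauss borel ((*v) A)) x = - (X *v x)" for x
    by (rule score_distr_gauss) (simp add: A SX)
  have ds: "data_score E \<sigma> s x = - (M *v x)" for x
    using M_inv by (simp add: data_score_def P_def)
  have "data_score E \<sigma> s x - score (distr gauss borel ((*v) A)) x = (X - M) *v x" for x
    by (simp add: sc ds matrix_vector_mult_diff_rdistrib)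
  moreover have [measurable]: "(*v) A \<in> borel_measurable borel" "(*v) (X - M) \<in> borel_measurable borel"
    by (simp_all add: linear_borel_measurable)
  ultimately have "(\<integral>\<^sup>+ x. ennreal ((norm (data_score E \<sigma> s x - score (add_noise s (generator_law (U, V))) x))\<^sup>2)
      \<partial>(add_noise s (generator_law (U, V)))) = (\<integral>\<^sup>+ z. ennreal ((norm (((X - M) ** A) *v z))\<^sup>2) \<partial>gauss)"
    by (simp add: law nn_integral_distr matrix_vector_mul_assoc)
  also have "\<dots> = ennreal (trace ((X - M) ** S ** (X - M)))"
    by (simp add: nn_integral_gauss_matrix norm_matrix_power2 matrix_transpose_mul transpose_diff X_sym M_sym
        matrix_mul_assoc flip: A)
  finally show ?thesis .
qed

text \<open>The part of the score error that involves \<open>U\<close> and \<open>V\<close>; the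
  remaining term of \<open>trace_score_error\<close> contains neither.\<close>

definition gap where
  "gap = \<alpha>\<^sup>2 * trace (H ** N ** transpose H)
    + (\<beta>\<^sup>2 - \<alpha>\<^sup>2) * (norm ((mat 1 - P) ** (U ** transpose V)))\<^sup>2"

lemma alpha_beta: "0 < \<alpha>" "\<alpha> < \<beta>" "\<alpha>\<^sup>2 < \<beta>\<^sup>2"
proof -
  have "0 < \<sigma>\<^sup>2 + s\<^sup>2" using s by (simp add: add_nonneg_pos)
  then show "0 < \<alpha>" "\<alpha> < \<beta>" by (auto simp: \<alpha>_def \<beta>_def field_simps)
  then show "\<alpha>\<^sup>2 < \<beta>\<^sup>2" by (intro power_strict_mono) auto
qed

lemma trace_HNH_ge: "(norm H)\<^sup>2 / ((onorm ((*v) V))\<^sup>2 + s\<^sup>2) \<le> trace (H ** N ** transpose H)"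
proof -
  define k where "k = (onorm ((*v) V))\<^sup>2 + s\<^sup>2"
  have "x \<bullet> (K *v x) \<le> k * (norm x)\<^sup>2" for x
  proof -
    have "norm (V *v x) \<le> onorm ((*v) V) * norm x"
      by (rule onorm) (simp add: linear_conv_bounded_linear[symmetric])
    then have "(norm (V *v x))\<^sup>2 \<le> (onorm ((*v) V) * norm x)\<^sup>2"
      by (rule power_mono) simp
    then show ?thesis by (simp add: inner_K k_def algebra_simps)
  qed
  moreover have "k > 0" using s by (simp add: k_def add_nonneg_pos)
  moreover have "0 \<le> x \<bullet> (K *v x)" for x by (simp add: inner_K)
  ultimately have "(norm (H $ i))\<^sup>2 / k \<le> H $ i \<bullet> (N *v H $ i)" for i
    by (intro inverse_quadratic_form_ge[OF K_sym KN])
  then show ?thesis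
    unfolding trace_conjugate norm_vec_power2[of H] sum_divide_distrib k_def[symmetric]
    by (rule sum_mono)
qed

lemma gap_ge:
  "gap \<ge> \<alpha>\<^sup>2 * ((norm H)\<^sup>2 / ((onorm ((*v) V))\<^sup>2 + s\<^sup>2))
    + (\<beta>\<^sup>2 - \<alpha>\<^sup>2) * (norm ((mat 1 - P) ** (U ** transpose V)))\<^sup>2"
  unfolding gap_def by (intro add_right_mono mult_left_mono trace_HNH_ge) simp

end

subsection \<open>Wasserstein distance for commuting covariances\<close>

lemma norm_projection_combination:
  fixes P :: "real^'d^'d"
  assumes P: "P ** P = P" "transpose P = P"
  shows "(norm (a *\<^sub>R P + b *\<^sub>R (mat 1 - P)))\<^sup>2 = a\<^sup>2 * trace P + b\<^sup>2 * (real CARD('d) - trace P)"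
proof -
  have "(a *\<^sub>R P + b *\<^sub>R (mat 1 - P)) ** transpose (a *\<^sub>R P + b *\<^sub>R (mat 1 - P))
      = a\<^sup>2 *\<^sub>R P + b\<^sup>2 *\<^sub>R (mat 1 - P)"
    by (simp add: matrix_algebra P power2_eq_square scaleR_right_diff_distrib scaleR_right_distrib)
  then show ?thesis
    by (simp only: norm_matrix_power2 trace_add trace_sub trace_scaleR trace_I)
qed

lemma nn_integral_distr_gauss_norm:
  fixes A :: "real^'n^'m" and B :: "real^'m^'k"
  shows "(\<integral>\<^sup>+x. ennreal ((norm (B *v x))\<^sup>2) \<partial>distr gauss borel ((*v) A)) = ennreal ((norm (B ** A))\<^sup>2)"
proof -
  have [measurable]: "(*v) A \<in> borel_measurable borel" "(*v) B \<in> borel_measurable borel"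
    by (simp_all add: linear_borel_measurable)
  show ?thesis
    by (simp add: nn_integral_distr matrix_vector_mul_assoc nn_integral_gauss_matrix)
qed

lemma coupling_cost_ge:
  fixes P C :: "real^'d^'d" and Q :: "((real^'d) \<times> (real^'d)) measure"
  assumes P: "P ** P = P" "transpose P = P" and a: "a > 0"
    and C: "C = a *\<^sub>R P + b *\<^sub>R (mat 1 - P)"
    and Q: "Q \<in> couplings (distr gauss borel ((*v) C)) (distr gauss borel ((*v) P))"
  shows "ennreal ((a - 1)\<^sup>2 * trace P + b\<^sup>2 * (real CARD('d) - trace P))
    \<le> (\<integral>\<^sup>+ (x, y). ennreal ((norm (x - y))\<^sup>2) \<partial>Q)"
proof -
  have sets [measurable_cong]: "sets Q = sets (borel \<Otimes>\<^sub>M borel)"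
    and fst: "distr Q borel fst = distr gauss borel ((*v) C)"
    and snd: "distr Q borel snd = distr gauss borel ((*v) P)"
    using Q by (auto simp: couplings_def)
  have [measurable]: "(*v) P \<in> borel_measurable borel"
    by (simp add: linear_borel_measurable)
  have m1: "(\<integral>\<^sup>+p. ennreal ((norm (B *v fst p))\<^sup>2) \<partial>Q) = ennreal ((norm (B ** C))\<^sup>2)" for B :: "real^'d^'d"
  proof -
    have [measurable]: "(*v) B \<in> borel_measurable borel" by (simp add: linear_borel_measurable)
    show ?thesis
      unfolding nn_integral_distr_gauss_norm[symmetric] fst[symmetric] by (subst nn_integral_distr) simp_all
  qed
  have m2': "(\<integral>\<^sup>+p. ennreal ((norm (B *v snd p))\<^sup>2) \<partial>Q) = ennreal ((norm (B ** P))\<^sup>2)" for B :: "real^'d^'d"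
  proof -
    have [measurable]: "(*v) B \<in> borel_measurable borel" by (simp add: linear_borel_measurable)
    show ?thesis
      unfolding nn_integral_distr_gauss_norm[symmetric] snd[symmetric] by (subst nn_integral_distr) simp_all
  qed
  have m2: "(\<integral>\<^sup>+p. ennreal ((norm (snd p))\<^sup>2) \<partial>Q) = ennreal ((norm P)\<^sup>2)"
    using m2'[of "mat 1"] by simp
  have m3: "(\<integral>\<^sup>+p. ennreal ((norm (fst p))\<^sup>2) \<partial>Q) = ennreal ((norm C)\<^sup>2)"
    using m1[of "mat 1"] by simp
  \<comment> \<open>The second marginal lives on the range of \<open>P\<close>, so
    \<open>x \<bullet> y\<close> sees only the projection of \<open>x\<close>.\<close>
  have "AE y in distr gauss borel ((*v) P). P *v y = y"
    by (subst AE_distr_iff) (simp_all add: matrix_vector_mul_assoc P)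
  then have "AE p in Q. P *v snd p = snd p"
    unfolding snd[symmetric] by (rule AE_distrD[rotated]) simp
  \<comment> \<open>Written with sums only, so that it can be integrated in
    \<open>[0, \<infinity>]\<close> without subtraction.\<close>
  then have ae: "AE p in Q. ennreal ((norm (fst p))\<^sup>2) + ennreal ((norm (snd p))\<^sup>2)
    \<le> ennreal ((norm (fst p - snd p))\<^sup>2)
       + (ennreal (1 / a) * ennreal ((norm (P *v fst p))\<^sup>2) + ennreal a * ennreal ((norm (snd p))\<^sup>2))"
  proof eventually_elim
    case (elim p)
    define x y where "x = fst p" and "y = snd p"
    have "x \<bullet> y = (P *v x) \<bullet> y"
      using elim by (simp add: inner_matrix_vector_left P x_def y_def)
    \<comment> \<open>The weight \<open>a\<close> makes the estimate sharp when
      \<open>P *v x = a *\<^sub>R y\<close>, which holds for \<open>x = C *v z\<close> and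
      \<open>y = P *v z\<close>.\<close>
    moreover have "(norm (P *v x - a *\<^sub>R y))\<^sup>2 = (norm (P *v x))\<^sup>2 + a\<^sup>2 * (norm y)\<^sup>2 - 2 * a * ((P *v x) \<bullet> y)"
      by (simp add: power2_norm_eq_inner inner_diff_left inner_diff_right inner_commute power2_eq_square[of a])
    then have "0 \<le> ((norm (P *v x))\<^sup>2 + a\<^sup>2 * (norm y)\<^sup>2 - 2 * a * ((P *v x) \<bullet> y)) / a"
      using a by (metis divide_nonneg_pos zero_le_power2)
    then have "0 \<le> (1 / a) * (norm (P *v x))\<^sup>2 - 2 * ((P *v x) \<bullet> y) + a * (norm y)\<^sup>2"
      using a by (simp add: diff_divide_distrib add_divide_distrib power2_eq_square[of a])
    moreover have "(norm (x - y))\<^sup>2 = (norm x)\<^sup>2 + (norm y)\<^sup>2 - 2 * (x \<bullet> y)"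
      by (simp add: power2_norm_eq_inner inner_simps inner_commute)
    ultimately have "(norm x)\<^sup>2 + (norm y)\<^sup>2 \<le> (norm (x - y))\<^sup>2 + ((1 / a) * (norm (P *v x))\<^sup>2 + a * (norm y)\<^sup>2)"
      by simp
    then show ?case
      using a unfolding x_def y_def by (simp flip: ennreal_plus ennreal_mult)
  qed
  have "ennreal ((norm C)\<^sup>2) + ennreal ((norm P)\<^sup>2)
      = (\<integral>\<^sup>+p. ennreal ((norm (fst p))\<^sup>2) + ennreal ((norm (snd p))\<^sup>2) \<partial>Q)"
    by (simp add: nn_integral_add m2 m3)
  also have "\<dots> \<le> (\<integral>\<^sup>+p. ennreal ((norm (fst p - snd p))\<^sup>2)
       + (ennreal (1 / a) * ennreal ((norm (P *v fst p))\<^sup>2) + ennreal a * ennreal ((norm (snd p))\<^sup>2)) \<partial>Q)"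
    by (rule nn_integral_mono_AE[OF ae])
  also have "\<dots> = (\<integral>\<^sup>+p. ennreal ((norm (fst p - snd p))\<^sup>2) \<partial>Q)
      + (ennreal (1 / a) * ennreal ((norm (P ** C))\<^sup>2) + ennreal a * ennreal ((norm P)\<^sup>2))"
    by (simp add: nn_integral_add nn_integral_cmult m1 m2)
  finally have le: "ennreal ((norm C)\<^sup>2) + ennreal ((norm P)\<^sup>2)
    \<le> (\<integral>\<^sup>+p. ennreal ((norm (fst p - snd p))\<^sup>2) \<partial>Q)
      + (ennreal (1 / a) * ennreal ((norm (P ** C))\<^sup>2) + ennreal a * ennreal ((norm P)\<^sup>2))" .
  have nP: "(norm P)\<^sup>2 = trace P"
    by (simp add: norm_matrix_power2 P)
  have "P ** C = a *\<^sub>R P" by (simp add: C matrix_algebra P)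
  then have nPC: "(norm (P ** C))\<^sup>2 = a\<^sup>2 * trace P"
    by (simp add: power_mult_distrib nP)
  have nC: "(norm C)\<^sup>2 = a\<^sup>2 * trace P + b\<^sup>2 * (real CARD('d) - trace P)"
    unfolding C by (rule norm_projection_combination[OF P])
  have "0 \<le> trace P"
    by (simp flip: nP)
  moreover have "trace P \<le> real CARD('d)"
    using norm_projection_combination[OF P, of 0 1] zero_le_power2[of "norm (mat 1 - P)"] by simp
  ultimately have nonneg: "0 \<le> trace P" "0 \<le> (a - 1)\<^sup>2 * trace P + b\<^sup>2 * (real CARD('d) - trace P)"
    "0 \<le> 2 * a * trace P"
    using a by auto
  \<comment> \<open>Adding the finite quantity \<open>2 * a * trace P\<close> to the claimed bound
    gives the sum of the two second moments; the same quantity is cancelled at the end.\<close>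
  have "ennreal ((a - 1)\<^sup>2 * trace P + b\<^sup>2 * (real CARD('d) - trace P)) + ennreal (2 * a * trace P)
    = ennreal ((a - 1)\<^sup>2 * trace P + b\<^sup>2 * (real CARD('d) - trace P) + 2 * a * trace P)"
    using nonneg by (simp only: ennreal_plus)
  also have "(a - 1)\<^sup>2 * trace P + b\<^sup>2 * (real CARD('d) - trace P) + 2 * a * trace P
      = (norm C)\<^sup>2 + (norm P)\<^sup>2"
    unfolding nC nP by (simp add: algebra_simps power2_eq_square)
  also have "ennreal \<dots> = ennreal ((norm C)\<^sup>2) + ennreal ((norm P)\<^sup>2)"
    by (rule ennreal_plus) simp_all
  also note le
  also have "ennreal (1 / a) * ennreal ((norm (P ** C))\<^sup>2) + ennreal a * ennreal ((norm P)\<^sup>2)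
      = ennreal ((1 / a) * (a\<^sup>2 * trace P) + a * trace P)"
    using a nonneg(1) unfolding nPC nP by (simp flip: ennreal_mult ennreal_plus)
  also have "(1 / a) * (a\<^sup>2 * trace P) + a * trace P = 2 * a * trace P"
    using a by (simp add: power2_eq_square)
  finally have "ennreal (2 * a * trace P) + ennreal ((a - 1)\<^sup>2 * trace P + b\<^sup>2 * (real CARD('d) - trace P))
    \<le> ennreal (2 * a * trace P) + (\<integral>\<^sup>+p. ennreal ((norm (fst p - snd p))\<^sup>2) \<partial>Q)"
    by (simp only: add.commute)
  then show ?thesis
    by (simp add: ennreal_add_left_cancel_le case_prod_beta')
qed

lemma W2_projection_combination:
  fixes P :: "real^'d^'d"
  assumes P: "P ** P = P" "transpose P = P" and a: "a > 0"
  shows "(W2 (distr gauss borel ((*v) (a *\<^sub>R P + b *\<^sub>R (mat 1 - P)))) (distr gauss borel ((*v) P)))\<^sup>2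
    = (a - 1)\<^sup>2 * trace P + b\<^sup>2 * (real CARD('d) - trace P)"
proof -
  define C where "C = a *\<^sub>R P + b *\<^sub>R (mat 1 - P)"
  define v where "v = (a - 1)\<^sup>2 * trace P + b\<^sup>2 * (real CARD('d) - trace P)"
  \<comment> \<open>Both components are driven by the same Gaussian vector; the cost of this
    coupling meets the lower bound.\<close>
  define Q where "Q = distr gauss (borel \<Otimes>\<^sub>M borel) (\<lambda>z. (C *v z, P *v z))"
  have [measurable]: "(*v) C \<in> borel_measurable borel" "(*v) P \<in> borel_measurable borel"
    by (simp_all add: linear_borel_measurable)
  have CP: "C - P = (a - 1) *\<^sub>R P + b *\<^sub>R (mat 1 - P)"
    by (simp add: C_def scaleR_left_diff_distrib)
  have v: "v = (norm (C - P))\<^sup>2"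
    unfolding CP v_def by (rule norm_projection_combination[OF P, symmetric])
  have "Q \<in> couplings (distr gauss borel ((*v) C)) (distr gauss borel ((*v) P))"
    unfolding couplings_def Q_def by (auto simp: distr_distr o_def)
  moreover have "(\<integral>\<^sup>+ (x, y). ennreal ((norm (x - y))\<^sup>2) \<partial>Q) = ennreal v"
    unfolding Q_def v nn_integral_gauss_matrix[symmetric]
    by (subst nn_integral_distr) (simp_all add: matrix_vector_mult_diff_rdistrib)
  ultimately have "(INF Q \<in> couplings (distr gauss borel ((*v) C)) (distr gauss borel ((*v) P)).
      \<integral>\<^sup>+ (x, y). ennreal ((norm (x - y))\<^sup>2) \<partial>Q) = ennreal v"
    using coupling_cost_ge[OF P a C_def] unfolding v_def
    by (intro antisym INF_greatest) (auto intro: INF_lower2)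
  then show ?thesis
    unfolding W2_def C_def[symmetric] v_def[symmetric] by (simp add: v)
qed

subsection \<open>Minimizers of the loss\<close>

context noise_level
begin

lemma gap_nonneg: "0 \<le> gap"
  using alpha_beta s by (intro order_trans[OF _ gap_ge] add_nonneg_nonneg mult_nonneg_nonneg divide_nonneg_nonneg) auto

lemma score_loss_eq:
  "(\<integral>\<^sup>+ x. ennreal ((norm (data_score E \<sigma> s x - score (add_noise s (generator_law (U, V))) x))\<^sup>2)
      \<partial>(add_noise s (generator_law (U, V))))
    = ennreal ((real CARD('d) - real CARD('r)) * s\<^sup>2 * (1 / s\<^sup>2 - 1 / (\<sigma>\<^sup>2 + s\<^sup>2))\<^sup>2 + gap)"
  unfolding expected_score_error trace_score_error by (simp add: gap_def \<beta>_def add.assoc)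

lemma gap_eq_0:
  assumes "transpose V ** V = (1 + \<sigma>\<^sup>2) *\<^sub>R mat 1" "(mat 1 - E ** transpose E) ** U = 0"
  shows "gap = 0"
proof -
  have "(mat 1 - P) ** (U ** transpose V) = 0"
    using assms(2) by (simp add: P_def matrix_mul_assoc)
  moreover have "H = 0"
    using assms(1) by (simp add: H_def W_def)
  ultimately show ?thesis by (simp add: gap_def trace_def)
qed

text \<open>A measurable minorant of the gap, positive unless the parameter has the claimed form.\<close>

definition gap_lower where
  "gap_lower = (1 / (1 + \<sigma>\<^sup>2 + s\<^sup>2))\<^sup>2 * ((norm (transpose V ** V - (1 + \<sigma>\<^sup>2) *\<^sub>R mat 1))\<^sup>2 / ((onorm ((*v) V))\<^sup>2 + s\<^sup>2))
    + ((1 / (\<sigma>\<^sup>2 + s\<^sup>2))\<^sup>2 - (1 / (1 + \<sigma>\<^sup>2 + s\<^sup>2))\<^sup>2) * (norm ((mat 1 - E ** transpose E) ** (U ** transpose V)))\<^sup>2"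

lemma gap_lower_le: "gap_lower \<le> gap"
  using gap_ge unfolding gap_lower_def \<alpha>_def \<beta>_def H_def W_def P_def by simp

lemma gap_lower_facts:
  shows "0 \<le> gap_lower"
    and "gap_lower \<le> 0 \<Longrightarrow> transpose V ** V = (1 + \<sigma>\<^sup>2) *\<^sub>R mat 1"
    and "gap_lower \<le> 0 \<Longrightarrow> (mat 1 - E ** transpose E) ** (U ** transpose V) = 0"
proof -
  define x where "x = (norm (transpose V ** V - (1 + \<sigma>\<^sup>2) *\<^sub>R mat 1))\<^sup>2"
  define y where "y = (norm ((mat 1 - E ** transpose E) ** (U ** transpose V)))\<^sup>2"
  define k where "k = (onorm ((*v) V))\<^sup>2 + s\<^sup>2"
  have k: "k > 0" using s by (simp add: k_def add_nonneg_pos)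
  have g: "gap_lower = \<alpha>\<^sup>2 * (x / k) + (\<beta>\<^sup>2 - \<alpha>\<^sup>2) * y"
    by (simp add: gap_lower_def \<alpha>_def \<beta>_def x_def y_def k_def)
  have 1: "0 \<le> \<alpha>\<^sup>2 * (x / k)" and 2: "0 \<le> (\<beta>\<^sup>2 - \<alpha>\<^sup>2) * y"
    using alpha_beta k by (simp_all add: x_def y_def)
  then show "0 \<le> gap_lower" by (simp add: g)
  show "transpose V ** V = (1 + \<sigma>\<^sup>2) *\<^sub>R mat 1" if "gap_lower \<le> 0"
  proof -
    have "\<alpha>\<^sup>2 * (x / k) = 0" using 1 2 that g by linarith
    then have "x = 0" using alpha_beta k by simp
    then show ?thesis by (simp add: x_def)
  qed
  show "(mat 1 - E ** transpose E) ** (U ** transpose V) = 0" if "gap_lower \<le> 0"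
  proof -
    have "(\<beta>\<^sup>2 - \<alpha>\<^sup>2) * y = 0" using 1 2 that g by linarith
    then have "y = 0" using alpha_beta by simp
    then show ?thesis by (simp add: y_def)
  qed
qed

end

text \<open>Finiteness allows the integral of \<open>f\<close> to be cancelled. Applied below with
  \<open>f\<close> the unavoidable error and \<open>g\<close> the minorant of the gap.\<close>

lemma nn_integral_add_eq_imp_null:
  assumes [measurable]: "f \<in> borel_measurable M" "g \<in> borel_measurable M"
    and le: "(\<integral>\<^sup>+x. f x + g x \<partial>M) \<le> (\<integral>\<^sup>+x. f x \<partial>M)" and fin: "(\<integral>\<^sup>+x. f x \<partial>M) < \<infinity>"
  shows "AE x in M. g x = (0::ennreal)"
proof -
  have "(\<integral>\<^sup>+x. f x \<partial>M) + (\<integral>\<^sup>+x. g x \<partial>M) \<le> (\<integral>\<^sup>+x. f x \<partial>M) + 0"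
    using le by (simp add: nn_integral_add)
  then have "(\<integral>\<^sup>+x. g x \<partial>M) \<le> 0"
    using fin by (subst (asm) ennreal_add_left_cancel_le) auto
  then show ?thesis by (simp add: nn_integral_0_iff_AE)
qed

section \<open>Averaging over the noise schedule\<close>

locale denoising =
  fixes E :: "real^'r^'d" and \<sigma> \<sigma>min \<sigma>max :: real and \<tau> :: "real \<Rightarrow> real"
  assumes E: "transpose E ** E = mat 1" and \<sigma>: "\<sigma> > 0" and \<sigma>min: "0 < \<sigma>min"
    and meas: "\<tau> \<in> borel_measurable (restrict_space borel {0<..<1})"
    and \<tau>: "\<forall>t\<in>{0<..<1}. \<sigma>min \<le> \<tau> t \<and> \<tau> t \<le> \<sigma>max"
begin

definition unif :: "real measure" where "unif = uniform_measure lborel {0<..<1}"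

text \<open>Outside the unit interval \<open>\<tau>\<close> is arbitrary, possibly nonmeasurable or zero.\<close>

definition \<tau>' where "\<tau>' = (\<lambda>t. if t \<in> {0<..<1} then \<tau> t else \<sigma>min)"

lemma prob_space_unif: "prob_space unif"
  unfolding unif_def by (rule prob_space_uniform_measure) simp_all

lemma sets_unif [measurable_cong]: "sets unif = sets borel"
  by (simp add: unif_def)

lemma \<tau>'_measurable [measurable]: "\<tau>' \<in> borel_measurable borel"
  unfolding \<tau>'_def using meas by (subst (asm) measurable_restrict_space_iff[where c=\<sigma>min]) auto

lemma \<tau>'_ge: "\<sigma>min \<le> \<tau>' t"
  using \<tau> by (simp add: \<tau>'_def)

lemma noise_level_at: "(U, V) \<in> Theta \<Longrightarrow> noise_level E \<sigma> (\<tau>' t) U V"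
  using E \<sigma> \<sigma>min \<tau>'_ge[of t] by unfold_locales (auto simp: Theta_def)

text \<open>The score error common to all parameters at time \<open>t\<close>, which is what remains
  when the gap vanishes.\<close>

definition base where
  "base t = (real CARD('d) - real CARD('r)) * (\<tau>' t)\<^sup>2 * (1 / (\<tau>' t)\<^sup>2 - 1 / (\<sigma>\<^sup>2 + (\<tau>' t)\<^sup>2))\<^sup>2"

text \<open>The uniform measure has no mass outside the unit interval, so \<open>\<tau>\<close> may
  be replaced by \<open>\<tau>'\<close>, whose values are positive noise levels at every
  \<open>t\<close>.\<close>

lemma loss_eq:
  assumes "(U, V) \<in> Theta"
  shows "loss E \<sigma> \<tau> (U, V) = (\<integral>\<^sup>+t. ennreal (base t + noise_level.gap E \<sigma> (\<tau>' t) U V) \<partial>unif)"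
  unfolding loss_def unif_def
proof (rule nn_integral_cong_AE, rule AE_uniform_measureI, simp, rule AE_I2, rule impI)
  fix t :: real assume "t \<in> {0<..<1}"
  then have "\<tau> t = \<tau>' t" by (simp add: \<tau>'_def)
  then show "(\<integral>\<^sup>+ x. ennreal ((norm (data_score E \<sigma> (\<tau> t) x - score (add_noise (\<tau> t) (generator_law (U, V))) x))\<^sup>2)
      \<partial>(add_noise (\<tau> t) (generator_law (U, V)))) = ennreal (base t + noise_level.gap E \<sigma> (\<tau>' t) U V)"
    using noise_level.score_loss_eq[OF noise_level_at[OF assms]] by (simp add: base_def)
qed

lemma r_le_d: "CARD('r) \<le> CARD('d)"
proof -
  have "inj ((*v) E)"
    using E matrix_left_invertible_injective[of E] by blast
  then have "dim (range ((*v) E)) = dim (UNIV :: (real^'r) set)"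
    by (intro dim_image_eq) auto
  moreover have "dim (range ((*v) E)) \<le> dim (UNIV :: (real^'d) set)"
    by (rule dim_subset) simp
  ultimately show ?thesis by simp
qed

lemma base_nonneg: "0 \<le> base t"
  unfolding base_def using r_le_d by simp

text \<open>The integrand is at most the codimension divided by \<open>\<sigma>min\<^sup>2\<close>.
  Finiteness is what permits cancelling this integral in \<open>minimizer\<close>.\<close>

lemma base_integral_finite: "(\<integral>\<^sup>+t. ennreal (base t) \<partial>unif) < \<infinity>"
proof -
  interpret prob_space unif by (rule prob_space_unif)
  define D where "D = real CARD('d) - real CARD('r)"
  have D: "D \<ge> 0" unfolding D_def using r_le_d by simp
  have "base t \<le> D / \<sigma>min\<^sup>2" for t
  proof -
    define q where "q = (\<tau>' t)\<^sup>2"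
    have q: "\<sigma>min\<^sup>2 \<le> q" "0 < q"
      unfolding q_def using \<tau>'_ge[of t] \<sigma>min by (auto intro: power_mono)
    have "1 / (\<sigma>\<^sup>2 + q) \<le> 1 / q"
      using q(2) by (intro frac_le) auto
    then have "(1 / q - 1 / (\<sigma>\<^sup>2 + q))\<^sup>2 \<le> (1 / q)\<^sup>2"
      using q(2) by (intro power_mono) auto
    then have "base t \<le> D * q * (1 / q)\<^sup>2"
      unfolding base_def q_def[symmetric] D_def[symmetric] using D q(2) by (intro mult_left_mono) auto
    also have "\<dots> = D / q" using q(2) by (simp add: power2_eq_square)
    also have "\<dots> \<le> D / \<sigma>min\<^sup>2" using D q \<sigma>min by (intro divide_left_mono) auto
    finally show ?thesis .
  qed
  then have "(\<integral>\<^sup>+t. ennreal (base t) \<partial>unif) \<le> (\<integral>\<^sup>+t. ennreal (D / \<sigma>min\<^sup>2) \<partial>unif)"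
    by (intro nn_integral_mono ennreal_leI)
  also have "\<dots> < \<infinity>" by (simp add: emeasure_space_1)
  finally show ?thesis .
qed

lemma base_measurable [measurable]: "base \<in> borel_measurable borel"
  unfolding base_def by measurable

lemma loss_ge: "(U, V) \<in> Theta \<Longrightarrow> (\<integral>\<^sup>+t. ennreal (base t) \<partial>unif) \<le> loss E \<sigma> \<tau> (U, V)"
  using noise_level.gap_nonneg[OF noise_level_at]
  by (simp add: loss_eq) (intro nn_integral_mono ennreal_leI, simp)

text \<open>One and the same parameter makes the gap vanish at every noise level, so it attains the
  pointwise lower bound and with it the lower bound of the integral.\<close>

lemma optimum:
  defines "V \<equiv> sqrt (1 + \<sigma>\<^sup>2) *\<^sub>R E"
  shows "(E, V) \<in> Theta" and "loss E \<sigma> \<tau> (E, V) = (\<integral>\<^sup>+t. ennreal (base t) \<partial>unif)"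
proof -
  have pos: "1 + \<sigma>\<^sup>2 > 0" by (simp add: add_pos_nonneg)
  have VV: "transpose V ** V = (1 + \<sigma>\<^sup>2) *\<^sub>R mat 1"
    using pos by (simp add: V_def matrix_algebra E)
  have "positive_definite (transpose V ** V)"
    using pos unfolding VV positive_definite_def
    by (auto simp: transpose_scalar inner_gt_zero_iff simp flip: scaleR_matrix_vector_assoc)
  then show th: "(E, V) \<in> Theta" by (simp add: Theta_def E)
  have "(mat 1 - E ** transpose E) ** E = 0"
    by (simp add: matrix_diff_rdistrib E flip: matrix_mul_assoc)
  then show "loss E \<sigma> \<tau> (E, V) = (\<integral>\<^sup>+t. ennreal (base t) \<partial>unif)"
    unfolding loss_eq[OF th] by (simp add: noise_level.gap_eq_0[OF noise_level_at[OF th] VV])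
qed

lemma is_arg_min_optimum:
  "is_arg_min (loss E \<sigma> \<tau>) (\<lambda>\<theta>. \<theta> \<in> Theta) (E, sqrt (1 + \<sigma>\<^sup>2) *\<^sub>R E)"
  unfolding is_arg_min_def optimum(2) using optimum(1) loss_ge by (auto simp: not_less)

text \<open>Comparison with the optimum forces the minorant of the gap to vanish for almost every
  \<open>t\<close>. A single such \<open>t\<close> suffices, because the two identities it yields do
  not involve \<open>t\<close>.\<close>

lemma minimizer:
  assumes "is_arg_min (loss E \<sigma> \<tau>) (\<lambda>\<theta>. \<theta> \<in> Theta) (U, V)"
  shows "transpose V ** V = (1 + \<sigma>\<^sup>2) *\<^sub>R mat 1" and "E ** transpose E ** U = U"
proof -
  have th: "(U, V) \<in> Theta" using assms by (simp add: is_arg_min_def)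
  interpret U: prob_space unif by (rule prob_space_unif)
  define g where "g = (\<lambda>t. noise_level.gap_lower E \<sigma> (\<tau>' t) U V)"
  note nl = noise_level_at[OF th]
  have [measurable]: "g \<in> borel_measurable borel"
    unfolding g_def noise_level.gap_lower_def[OF nl] by measurable
  have g0: "0 \<le> g t" for t unfolding g_def by (rule noise_level.gap_lower_facts(1)[OF nl])
  have "(\<integral>\<^sup>+t. ennreal (base t) + ennreal (g t) \<partial>unif) = (\<integral>\<^sup>+t. ennreal (base t + g t) \<partial>unif)"
    using g0 base_nonneg by simp
  also have "\<dots> \<le> loss E \<sigma> \<tau> (U, V)"
    unfolding loss_eq[OF th] g_def
    by (intro nn_integral_mono ennreal_leI add_left_mono noise_level.gap_lower_le[OF nl])
  also have "\<dots> \<le> (\<integral>\<^sup>+t. ennreal (base t) \<partial>unif)"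
    using assms optimum by (metis is_arg_min_def not_less)
  finally have "AE t in unif. ennreal (g t) = 0"
    by (intro nn_integral_add_eq_imp_null[OF _ _ _ base_integral_finite])
       (simp_all add: measurable_cong_sets[OF sets_unif refl])
  then obtain t where "ennreal (g t) = 0"
    using U.AE_False eventually_mono by (metis (mono_tags, lifting))
  then have "noise_level.gap_lower E \<sigma> (\<tau>' t) U V \<le> 0"
    unfolding g_def by (simp add: ennreal_eq_0_iff)
  note res = noise_level.gap_lower_facts(2,3)[OF nl this]
  show VV: "transpose V ** V = (1 + \<sigma>\<^sup>2) *\<^sub>R mat 1" by (rule res(1))
  have pos: "1 + \<sigma>\<^sup>2 > 0" by (simp add: add_pos_nonneg)
  \<comment> \<open>Multiplying by \<open>V\<close> on the right produces
    \<open>transpose V ** V\<close>, a nonzero multiple of the identity, and so frees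
    \<open>U\<close> from \<open>transpose V\<close>.\<close>
  have "(mat 1 - E ** transpose E) ** (U ** (transpose V ** V)) = 0"
    using res(2) by (metis matrix_mul_assoc times0_left)
  then have "(1 + \<sigma>\<^sup>2) *\<^sub>R ((mat 1 - E ** transpose E) ** U) = 0"
    by (simp add: VV matrix_scalar_ac flip: scalar_matrix_assoc)
  then have "(mat 1 - E ** transpose E) ** U = 0"
    using pos by simp
  then show "E ** transpose E ** U = U"
    by (simp add: matrix_diff_rdistrib)
qed

end

section \<open>Transfer to the stated laws, minimizers and distances\<close>

theorem theorem1:
  fixes E :: "real^'r^'d" and \<sigma> \<sigma>min \<sigma>max :: real and \<tau> :: "real \<Rightarrow> real"
    and pX pY :: "(real^'d) measure"
  assumes "CARD('r) < CARD('d)"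
    and "transpose E ** E = mat 1"
    and "\<sigma> > 0"
    and "pX = normal_law 0 (E ** transpose E)"
    and "pY = normal_law 0 (E ** transpose E + \<sigma>\<^sup>2 *\<^sub>R mat 1)"
    and "0 < \<sigma>min" and "\<sigma>min < \<sigma>max"
    and "\<tau> \<in> borel_measurable (restrict_space borel {0<..<1})"
    and "\<forall>t\<in>{0<..<1}. \<sigma>min \<le> \<tau> t \<and> \<tau> t \<le> \<sigma>max"
  shows "pY = add_noise \<sigma> pX \<and>
    (\<forall>(U, V) \<in> (Theta :: ('r, 'd) param set).
      generator_law (U, V) = normal_law 0 (U ** transpose V ** V ** transpose U) \<and>
      (\<forall>t\<in>{0<..<1}. add_noise (\<tau> t) (generator_law (U, V)) =
         normal_law 0 (U ** transpose V ** V ** transpose U + (\<tau> t)\<^sup>2 *\<^sub>R mat 1))) \<and>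
    (\<exists>\<theta>. is_arg_min (loss E \<sigma> \<tau>) (\<lambda>\<theta>. \<theta> \<in> Theta) \<theta>) \<and>
    (\<forall>U V. is_arg_min (loss E \<sigma> \<tau>) (\<lambda>\<theta>. \<theta> \<in> Theta) (U, V) \<longrightarrow>
      (\<exists>Q :: real^'r^'r. orthogonal_matrix Q \<and> U = E ** Q) \<and>
      transpose V ** V = (1 + \<sigma>\<^sup>2) *\<^sub>R mat 1 \<and>
      generator_law (U, V) = normal_law 0 ((1 + \<sigma>\<^sup>2) *\<^sub>R (E ** transpose E)) \<and>
      (W2 (generator_law (U, V)) pX)\<^sup>2 =
        (W2 pY pX)\<^sup>2 - (real CARD('d) - real CARD('r)) * \<sigma>\<^sup>2 \<and>
      (W2 pY pX)\<^sup>2 - (real CARD('d) - real CARD('r)) * \<sigma>\<^sup>2 < (W2 pY pX)\<^sup>2)"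
proof -
  interpret denoising E \<sigma> \<sigma>min \<sigma>max \<tau>
    using assms by unfold_locales auto
  define P where "P = E ** transpose E"
  have P: "P ** P = P" "transpose P = P" "trace P = real CARD('r)"
    using projection_facts[OF E] by (simp_all add: P_def matrix_transpose_mul)
  define a where "a = sqrt (1 + \<sigma>\<^sup>2)"
  have a: "a > 0" "a\<^sup>2 = 1 + \<sigma>\<^sup>2" by (simp_all add: a_def add_pos_nonneg)
  \<comment> \<open>One family of symmetric square roots serves both laws: \<open>b = 0\<close>
    gives the optimal generator and \<open>b = \<sigma>\<close> gives \<open>pY\<close>. Their costs
    differ by \<open>\<sigma>\<^sup>2\<close> times the codimension.\<close>
  have cov: "(a *\<^sub>R P + b *\<^sub>R (mat 1 - P)) ** transpose (a *\<^sub>R P + b *\<^sub>R (mat 1 - P))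
      = (1 + \<sigma>\<^sup>2) *\<^sub>R P + b\<^sup>2 *\<^sub>R (mat 1 - P)" for b
    unfolding a(2)[symmetric]
    by (simp add: matrix_algebra P power2_eq_square scaleR_right_diff_distrib scaleR_right_distrib)
  have law: "normal_law 0 ((1 + \<sigma>\<^sup>2) *\<^sub>R P + b\<^sup>2 *\<^sub>R (mat 1 - P))
      = distr gauss borel ((*v) (a *\<^sub>R P + b *\<^sub>R (mat 1 - P)))" for b
    by (rule normal_law_eq_distr_matrix[OF cov])
  have pX: "pX = distr gauss borel ((*v) P)"
    unfolding assms(4) P_def[symmetric] by (rule normal_law_eq_distr_matrix) (simp add: P)
  have noisy: "P + \<sigma>\<^sup>2 *\<^sub>R mat 1 = (1 + \<sigma>\<^sup>2) *\<^sub>R P + \<sigma>\<^sup>2 *\<^sub>R (mat 1 - P)"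
    by (simp add: scaleR_left_distrib scaleR_right_diff_distrib)
  have pY: "pY = distr gauss borel ((*v) (a *\<^sub>R P + \<sigma> *\<^sub>R (mat 1 - P)))"
    unfolding assms(5) P_def[symmetric] noisy by (rule law)
  have noise: "pY = add_noise \<sigma> pX"
    unfolding pX add_noise_distr assms(5) by (simp add: P P_def[symmetric])
  have gen: "generator_law (U, V) = normal_law 0 (U ** transpose V ** V ** transpose U)"
    "add_noise s (generator_law (U, V)) = normal_law 0 (U ** transpose V ** V ** transpose U + s\<^sup>2 *\<^sub>R mat 1)"
    for U V :: "real^'r^'d" and s
  proof -
    have UV: "(U ** transpose V) ** transpose (U ** transpose V) = U ** transpose V ** V ** transpose U"
      by (simp add: matrix_transpose_mul matrix_mul_assoc)
    show "generator_law (U, V) = normal_law 0 (U ** transpose V ** V ** transpose U)"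
      unfolding generator_law_eq by (rule normal_law_eq_distr_matrix[OF UV, symmetric])
    show "add_noise s (generator_law (U, V)) = normal_law 0 (U ** transpose V ** V ** transpose U + s\<^sup>2 *\<^sub>R mat 1)"
      unfolding generator_law_eq add_noise_distr UV ..
  qed
  have pos: "0 < (real CARD('d) - real CARD('r)) * \<sigma>\<^sup>2"
    using assms(1,3) by simp
  have minimizers: "(\<exists>Q :: real^'r^'r. orthogonal_matrix Q \<and> U = E ** Q) \<and>
      transpose V ** V = (1 + \<sigma>\<^sup>2) *\<^sub>R mat 1 \<and>
      generator_law (U, V) = normal_law 0 ((1 + \<sigma>\<^sup>2) *\<^sub>R (E ** transpose E)) \<and>
      (W2 (generator_law (U, V)) pX)\<^sup>2 = (W2 pY pX)\<^sup>2 - (real CARD('d) - real CARD('r)) * \<sigma>\<^sup>2 \<and>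
      (W2 pY pX)\<^sup>2 - (real CARD('d) - real CARD('r)) * \<sigma>\<^sup>2 < (W2 pY pX)\<^sup>2"
    if min: "is_arg_min (loss E \<sigma> \<tau>) (\<lambda>\<theta>. \<theta> \<in> Theta) (U, V)" for U V
  proof -
    note VV = minimizer(1)[OF min] and EU = minimizer(2)[OF min]
    have U: "transpose U ** U = mat 1" using min by (simp add: is_arg_min_def Theta_def)
    \<comment> \<open>The columns of \<open>U\<close> lie in the range of \<open>E\<close>;
      \<open>Q\<close> holds their coordinates in the orthonormal columns of
      \<open>E\<close>.\<close>
    define Q where "Q = transpose E ** U"
    have UQ: "U = E ** Q" using EU by (simp add: Q_def matrix_mul_assoc)
    have "transpose Q ** Q = transpose U ** (E ** transpose E ** U)"
      by (simp add: Q_def matrix_transpose_mul matrix_mul_assoc)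
    then have Q: "orthogonal_matrix Q" by (simp add: EU U orthogonal_matrix)
    then have "Q ** transpose Q = mat 1" by (simp add: orthogonal_matrix_def)
    then have UU: "U ** transpose U = P"
      unfolding UQ P_def matrix_transpose_mul by (metis matrix_mul_assoc matrix_mul_rid)
    have "U ** transpose V ** V ** transpose U = U ** (transpose V ** V) ** transpose U"
      by (simp add: matrix_mul_assoc)
    also have "\<dots> = (1 + \<sigma>\<^sup>2) *\<^sub>R P"
      unfolding VV by (simp add: matrix_scalar_ac UU flip: scalar_matrix_assoc)
    finally have g: "generator_law (U, V) = normal_law 0 ((1 + \<sigma>\<^sup>2) *\<^sub>R P)"
      using gen(1) by simp
    have "(W2 (generator_law (U, V)) pX)\<^sup>2 = (a - 1)\<^sup>2 * trace P + 0\<^sup>2 * (real CARD('d) - trace P)"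
      using W2_projection_combination[OF P(1,2) a(1), of 0] law[of 0] unfolding g pX by simp
    moreover have "(W2 pY pX)\<^sup>2 = (a - 1)\<^sup>2 * trace P + \<sigma>\<^sup>2 * (real CARD('d) - trace P)"
      unfolding pY pX by (rule W2_projection_combination[OF P(1,2) a(1)])
    ultimately show ?thesis
      using Q UQ VV g pos unfolding P(3) by (auto simp: P_def mult.commute)
  qed
  show ?thesis
  proof (intro conjI)
    show "\<forall>(U, V) \<in> (Theta :: ('r, 'd) param set).
      generator_law (U, V) = normal_law 0 (U ** transpose V ** V ** transpose U) \<and>
      (\<forall>t\<in>{0<..<1}. add_noise (\<tau> t) (generator_law (U, V)) =
         normal_law 0 (U ** transpose V ** V ** transpose U + (\<tau> t)\<^sup>2 *\<^sub>R mat 1))"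
      unfolding gen(2) using gen(1) by blast
  qed (use noise is_arg_min_optimum minimizers in blast)+
qed

end
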